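(* Let $d\ge 2$ and let $\mu$ be a minimizer, over all Borel probability measures on $\mathbb{S}^{d-1}$, of the three-point $1$-frame energy $$I(\mu)=\int_{\mathbb{S}^{d-1}}\int_{\mathbb{S}^{d-1}}\int_{\mathbb{S}^{d-1}}\left|\langle x,y\rangle\langle x,z\rangle\langle y,z\rangle\right|\,d\mu(x)\,d\mu(y)\,d\mu(z).$$ Then the Hausdorff dimension of the support of $\mu$ is at most $d-2$.
   Context: $\mathbb{S}^{d-1}$ is the unit sphere of $\mathbb{R}^d$ and $\langle\cdot,\cdot\rangle$ the Euclidean inner product. *)

theory Defs
  imports "HOL-Probability.Probability"
begin

definition sphere_prob :: "('a::euclidean_space) measure \<Rightarrow> bool" where
  "sphere_prob M \<longleftrightarrow> prob_space M \<and> sets M = sets (restrict_space borel (sphere (0::'a) 1))"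

definition frame3_energy :: "('a::euclidean_space) measure \<Rightarrow> real" where
  "frame3_energy M =
     (\<integral>x. (\<integral>y. (\<integral>z. \<bar>(x \<bullet> y) * (x \<bullet> z) * (y \<bullet> z)\<bar> \<partial>M) \<partial>M) \<partial>M)"

definition msupport :: "('a::metric_space) measure \<Rightarrow> 'a set" where
  "msupport M = {x \<in> space M. \<forall>e>0. emeasure M (ball x e \<inter> space M) > 0}"

definition hgauge :: "real \<Rightarrow> ('a::metric_space) set \<Rightarrow> real" where
  "hgauge s U = (if U = {} then 0 else if s = 0 then 1 else diameter U powr s)"

definition hausdorff_approx :: "real \<Rightarrow> real \<Rightarrow> ('a::metric_space) set \<Rightarrow> ennreal" where
  "hausdorff_approx s \<delta> A =
     (INF U \<in> {U :: nat \<Rightarrow> 'a set. A \<subseteq> (\<Union>i. U i) \<and> (\<forall>i. bounded (U i) \<and> diameter (U i) \<le> \<delta>)}.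
        (\<Sum>i. ennreal (hgauge s (U i))))"

definition hausdorff_outer :: "real \<Rightarrow> ('a::metric_space) set \<Rightarrow> ennreal" where
  "hausdorff_outer s A = (SUP \<delta> \<in> {0<..}. hausdorff_approx s \<delta> A)"

definition hausdorff_dim :: "('a::metric_space) set \<Rightarrow> real" where
  "hausdorff_dim A = Inf {s. 0 \<le> s \<and> hausdorff_outer s A = 0}"

end

theory Submission
  imports Defs
begin

text \<open>
  Let \<open>S\<close> be the support of the minimizer, \<open>I\<close> its energy, \<open>F\<close> its potential, and
  \<open>G x y = |x \<bullet> y| H x y\<close> with \<open>H x y = \<integral> |x \<bullet> z| |y \<bullet> z|\<close>. The first variation gives \<open>F \<ge> I\<close> on the
  sphere with equality on \<open>S\<close>; the second variation makes \<open>G\<close> conditionally positive definite on \<open>S\<close>.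

  If \<open>x\<^sub>0 \<in> S\<close> is orthogonal to no point of \<open>S\<close>, then \<open>F\<close> is a quadratic form near \<open>x\<^sub>0\<close>, so \<open>F v - I |v|\<^sup>2\<close>
  is positive semidefinite and \<open>S\<close> lies locally in its kernel, a proper subspace.
  If \<open>x, x' \<in> S\<close> are orthogonal to \<open>y, y' \<in> S\<close> respectively, the kink of \<open>G\<close> and conditional positivity force
  \<open>|x' \<bullet> y| = O(|x - x'| |y - y'|)\<close> (unless \<open>H\<close> vanishes somewhere on \<open>S \<times> S\<close>, when \<open>S\<close> lies in two
  hyperplanes), so these points locally form a Lipschitz graph in the sphere over a space of
  dimension \<open>d - 2\<close>.
\<close>

subsection \<open>Null sets of Hausdorff measures\<close>

lemma hausdorff_outer_eq_0_iff:
  "hausdorff_outer s A = 0 \<longleftrightarrow> (\<forall>\<delta>>0. hausdorff_approx s \<delta> A = 0)"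
  unfolding hausdorff_outer_def by (simp add: SUP_eq_iff flip: bot_ennreal) (auto simp: SUP_bot_conv)

lemma hausdorff_approx_mono: "A \<subseteq> B \<Longrightarrow> hausdorff_approx s \<delta> A \<le> hausdorff_approx s \<delta> B"
  unfolding hausdorff_approx_def by (intro INF_superset_mono) auto

lemma hausdorff_null_subset: "hausdorff_outer s B = 0 \<Longrightarrow> A \<subseteq> B \<Longrightarrow> hausdorff_outer s A = 0"
  unfolding hausdorff_outer_eq_0_iff using hausdorff_approx_mono by (metis le_zero_eq)

lemma hausdorff_approx_less_cover:
  assumes "hausdorff_approx s \<delta> A < e"
  obtains U :: "nat \<Rightarrow> 'a::metric_space set" where "A \<subseteq> (\<Union>i. U i)" "\<And>i. bounded (U i)"
    "\<And>i. diameter (U i) \<le> \<delta>" "(\<Sum>i. ennreal (hgauge s (U i))) < e"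
  using assms unfolding hausdorff_approx_def INF_less_iff by auto

lemma hausdorff_null_UN:
  fixes A :: "nat \<Rightarrow> 'a::metric_space set"
  assumes null: "\<And>k. hausdorff_outer s (A k) = 0"
  shows "hausdorff_outer s (\<Union>k. A k) = 0"
  unfolding hausdorff_outer_eq_0_iff
proof (intro allI impI)
  fix \<delta> :: real assume "\<delta> > 0"
  have "hausdorff_approx s \<delta> (\<Union>k. A k) \<le> 0 + ennreal e" if "e > 0" for e
  proof -
    have "\<exists>U. A k \<subseteq> (\<Union>i. U i) \<and> (\<forall>i. bounded (U i) \<and> diameter (U i) \<le> \<delta>) \<and>
        (\<Sum>i. ennreal (hgauge s (U i))) < ennreal (e * (1/2) ^ Suc k)" for k
    proof -
      have "hausdorff_approx s \<delta> (A k) < ennreal (e * (1/2) ^ Suc k)"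
        using null[of k] \<open>\<delta> > 0\<close> that by (simp add: hausdorff_outer_eq_0_iff)
      then show ?thesis by (metis hausdorff_approx_less_cover)
    qed
    then obtain U where U: "\<And>k. A k \<subseteq> (\<Union>i. U k i)"
      "\<And>k i. bounded (U k i)" "\<And>k i. diameter (U k i) \<le> \<delta>"
      "\<And>k. (\<Sum>i. ennreal (hgauge s (U k i))) < ennreal (e * (1/2) ^ Suc k)"
      by metis
    define V where "V n = case_prod U (prod_decode n)" for n
    have cov: "(\<Union>k. A k) \<subseteq> (\<Union>i. V i)"
    proof clarify
      fix x k assume "x \<in> A k"
      then obtain i where "x \<in> U k i" using U(1) by blast
      then have "x \<in> V (prod_encode (k, i))" by (simp add: V_def)
      then show "x \<in> (\<Union>i. V i)" by blast
    qed
    have "hausdorff_approx s \<delta> (\<Union>k. A k) \<le> (\<Sum>i. ennreal (hgauge s (V i)))"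
      unfolding hausdorff_approx_def
      by (rule INF_lower) (use cov U(2,3) in \<open>auto simp: V_def split: prod.split\<close>)
    also have "\<dots> = (\<Sum>k. \<Sum>i. ennreal (hgauge s (U k i)))"
      using suminf_ennreal_2dimen[of "\<lambda>k. \<Sum>i. ennreal (hgauge s (U k i))"
          "\<lambda>(k, i). ennreal (hgauge s (U k i))"]
      by (simp add: V_def split_beta)
    also have "\<dots> \<le> (\<Sum>k. ennreal (e * (1/2) ^ Suc k))"
      using U(4) by (intro suminf_le) (auto intro: less_imp_le simp del: power_Suc)
    also have "\<dots> = ennreal e"
    proof (rule suminf_ennreal_eq)
      show "(\<lambda>k. e * (1/2) ^ Suc k) sums e"
        using sums_mult[OF power_half_series, of e] by simp
    qed (use that in auto)
    finally show ?thesis by simp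
  qed
  then have "hausdorff_approx s \<delta> (\<Union>k. A k) \<le> 0"
    by (rule ennreal_le_epsilon)
  then show "hausdorff_approx s \<delta> (\<Union>k. A k) = 0" by simp
qed

lemma hausdorff_approx_empty [simp]: "\<delta> \<ge> 0 \<Longrightarrow> hausdorff_approx s \<delta> {} = 0"
  unfolding hausdorff_approx_def
  by (intro antisym[OF INF_lower2[of "\<lambda>_. {}"]]) (auto simp: hgauge_def)

lemma hausdorff_null_empty [simp]: "hausdorff_outer s {} = 0"
  by (simp add: hausdorff_outer_eq_0_iff)

lemma hausdorff_null_countable_Union:
  assumes "countable C" "\<And>X. X \<in> C \<Longrightarrow> hausdorff_outer s X = 0"
  shows "hausdorff_outer s (\<Union>C) = 0"
proof (cases "C = {}")
  case False
  then have "\<Union>C = (\<Union>k. from_nat_into C k)"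
    using assms(1) by (metis range_from_nat_into)
  then show ?thesis
    using hausdorff_null_UN[of s "from_nat_into C"] False assms(2)
    by (metis from_nat_into)
qed auto

lemma hausdorff_null_Un:
  "hausdorff_outer s A = 0 \<Longrightarrow> hausdorff_outer s B = 0 \<Longrightarrow> hausdorff_outer s (A \<union> B) = 0"
  using hausdorff_null_countable_Union[of "{A, B}" s] by auto

lemma hausdorff_null_locally:
  fixes A :: "'a::euclidean_space set"
  assumes "\<And>x. x \<in> A \<Longrightarrow> \<exists>r>0. hausdorff_outer s (A \<inter> ball x r) = 0"
  shows "hausdorff_outer s A = 0"
proof -
  define F where "F = {U. open U \<and> hausdorff_outer s (A \<inter> U) = 0}"
  obtain F' where F': "F' \<subseteq> F" "countable F'" "\<Union>F' = \<Union>F"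
    using Lindelof[of F] by (auto simp: F_def)
  have "A \<subseteq> \<Union>F"
    using assms by (fastforce simp: F_def intro: centre_in_ball[THEN iffD2])
  then have "A \<subseteq> \<Union>((\<inter>) A ` F')" using F'(3) by blast
  moreover have "hausdorff_outer s (\<Union>((\<inter>) A ` F')) = 0"
    using F' by (intro hausdorff_null_countable_Union) (auto simp: F_def)
  ultimately show ?thesis using hausdorff_null_subset by blast
qed

lemma hausdorff_approx_finite_cover:
  fixes U :: "'i \<Rightarrow> 'a::metric_space set"
  assumes "finite J" "E \<subseteq> (\<Union>j\<in>J. U j)" "\<And>j. j \<in> J \<Longrightarrow> bounded (U j)"
    and "\<And>j. j \<in> J \<Longrightarrow> diameter (U j) \<le> \<delta>" "0 < s" "0 \<le> \<delta>"
  shows "hausdorff_approx s \<delta> E \<le> ennreal (real (card J) * \<delta> powr s)"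
proof -
  obtain h where h: "bij_betw h {0..<card J} J"
    using ex_bij_betw_nat_finite[OF assms(1)] by auto
  define V where "V i = (if i < card J then U (h i) else {})" for i
  have hJ: "h i \<in> J" if "i < card J" for i
    using h that by (auto simp: bij_betw_def)
  have "E \<subseteq> (\<Union>i. V i)"
  proof
    fix x assume "x \<in> E"
    then obtain j where "j \<in> J" "x \<in> U j" using assms(2) by auto
    moreover from this obtain i where "i < card J" "h i = j"
      using h by (auto simp: bij_betw_def image_iff) (metis atLeastLessThan_iff imageE)
    ultimately show "x \<in> (\<Union>i. V i)" by (auto simp: V_def)
  qed
  then have "hausdorff_approx s \<delta> E \<le> (\<Sum>i. ennreal (hgauge s (V i)))"
    unfolding hausdorff_approx_def
    by (intro INF_lower) (use hJ assms in \<open>auto simp: V_def\<close>)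
  also have "\<dots> = (\<Sum>i<card J. ennreal (hgauge s (V i)))"
    by (rule suminf_finite) (auto simp: V_def hgauge_def)
  also have "\<dots> \<le> (\<Sum>i<card J. ennreal (\<delta> powr s))"
    by (intro sum_mono ennreal_leI)
      (use assms hJ in \<open>auto simp: V_def hgauge_def diameter_ge_0 intro!: powr_mono2\<close>)
  finally show ?thesis by (simp add: ennreal_of_nat_eq_real_of_nat ennreal_mult)
qed

lemma dim_orthogonal_complement_pair:
  fixes a b :: "'a::euclidean_space"
  assumes "norm a = 1" "norm b = 1" "a \<bullet> b = 0"
  shows "dim {w. w \<bullet> a = 0 \<and> w \<bullet> b = 0} = DIM('a) - 2"
proof -
  have "a \<noteq> b" using assms by (auto simp: norm_eq_1)
  have "independent {a, b}"
    using assms by (intro pairwise_orthogonal_independent)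
      (auto simp: pairwise_def orthogonal_def inner_commute)
  then have "dim (span {a, b}) = 2" using \<open>a \<noteq> b\<close> by (simp add: dim_eq_card_independent)
  moreover have "{w. w \<bullet> a = 0 \<and> w \<bullet> b = 0} = {y \<in> UNIV. \<forall>x\<in>span {a, b}. orthogonal x y}"
  proof (intro set_eqI iffI)
    fix w assume "w \<in> {w. w \<bullet> a = 0 \<and> w \<bullet> b = 0}"
    then have "orthogonal w x" if "x \<in> span {a, b}" for x
      using that by (intro orthogonal_to_span[of x "{a,b}"]) (auto simp: orthogonal_def inner_commute)
    then show "w \<in> {y \<in> UNIV. \<forall>x\<in>span {a, b}. orthogonal x y}"
      by (auto simp: orthogonal_commute)
  qed (auto simp: orthogonal_def inner_commute span_base)
  ultimately show ?thesis
    using dim_subspace_orthogonal_to_vectors[of "span {a, b}" "UNIV :: 'a set"] by simp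
qed

definition thin :: "'a::euclidean_space set \<Rightarrow> bool" where
  "thin E \<longleftrightarrow> E \<subseteq> cball 0 1 \<and> (\<exists>a b. norm a = 1 \<and> norm b = 1 \<and> a \<bullet> b = 0 \<and>
     (\<forall>x\<in>E. \<forall>y\<in>E. \<bar>(x - y) \<bullet> a\<bar> \<le> norm (x - y) / 4 \<and> \<bar>(x - y) \<bullet> b\<bar> \<le> norm (x - y) / 4))"

lemma thin_null:
  fixes E :: "'a::euclidean_space set"
  assumes "thin E" and s: "s > real DIM('a) - 2" "s > 0" and dim: "DIM('a) \<ge> 2"
  shows "hausdorff_outer s E = 0"
proof -
  obtain a b where ab: "norm a = 1" "norm b = 1" "a \<bullet> b = 0"
    and thin: "\<And>x y. x \<in> E \<Longrightarrow> y \<in> E \<Longrightarrow> \<bar>(x - y) \<bullet> a\<bar> \<le> norm (x - y) / 4"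
      "\<And>x y. x \<in> E \<Longrightarrow> y \<in> E \<Longrightarrow> \<bar>(x - y) \<bullet> b\<bar> \<le> norm (x - y) / 4"
    using assms(1) unfolding thin_def by blast
  have E1: "norm x \<le> 1" if "x \<in> E" for x
    using assms(1) that by (auto simp: thin_def)
  define W where "W = {w. w \<bullet> a = 0 \<and> w \<bullet> b = 0}"
  have "subspace W" by (auto simp: W_def subspace_def inner_add_left)
  then obtain B where B: "B \<subseteq> W" "pairwise orthogonal B" "\<And>x. x \<in> B \<Longrightarrow> norm x = 1"
    "independent B" "card B = dim W" "span B = W"
    using orthonormal_basis_subspace[of W] by metis
  have finB: "finite B" using B(4) by (rule independent_imp_finite)
  define k where "k = DIM('a) - 2"
  have cardB: "card B = k"
    using B(5) dim_orthogonal_complement_pair[OF ab] by (simp add: W_def k_def)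
  have expand: "norm w \<le> \<bar>w \<bullet> a\<bar> + \<bar>w \<bullet> b\<bar> + (\<Sum>e\<in>B. \<bar>w \<bullet> e\<bar>)" for w
  proof -
    define w' where "w' = w - (w \<bullet> a) *\<^sub>R a - (w \<bullet> b) *\<^sub>R b"
    have "w' \<in> W"
      using ab by (simp add: w'_def W_def inner_diff_left inner_commute[of b a] norm_eq_1)
    then have "w' = (\<Sum>e\<in>B. (w' \<bullet> e) *\<^sub>R e)"
      using orthonormal_basis_expand[OF B(2,3) _ finB, of w'] B(6) by simp
    also have "\<dots> = (\<Sum>e\<in>B. (w \<bullet> e) *\<^sub>R e)"
    proof (rule sum.cong)
      fix e assume "e \<in> B"
      then have "a \<bullet> e = 0" "b \<bullet> e = 0" using B(1) by (auto simp: W_def inner_commute)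
      then show "(w' \<bullet> e) *\<^sub>R e = (w \<bullet> e) *\<^sub>R e" by (simp add: w'_def inner_diff_left)
    qed simp
    finally have "w = (w \<bullet> a) *\<^sub>R a + (w \<bullet> b) *\<^sub>R b + (\<Sum>e\<in>B. (w \<bullet> e) *\<^sub>R e)"
      by (simp add: w'_def algebra_simps)
    then have "norm w = norm ((w \<bullet> a) *\<^sub>R a + (w \<bullet> b) *\<^sub>R b + (\<Sum>e\<in>B. (w \<bullet> e) *\<^sub>R e))"
      by (rule arg_cong)
    also have "\<dots> \<le> norm ((w \<bullet> a) *\<^sub>R a) + norm ((w \<bullet> b) *\<^sub>R b) + norm (\<Sum>e\<in>B. (w \<bullet> e) *\<^sub>R e)"
      by (intro norm_triangle_le add_right_mono norm_triangle_ineq)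
    also have "norm (\<Sum>e\<in>B. (w \<bullet> e) *\<^sub>R e) \<le> (\<Sum>e\<in>B. \<bar>w \<bullet> e\<bar>)"
      using B(3) by (intro sum_norm_le) auto
    finally show ?thesis using ab by simp
  qed
  define J where "J n = (PiE B (\<lambda>_. {- int n..int n}))" for n
  define U where "U n j = {x \<in> E. \<forall>e\<in>B. \<lfloor>real n * (x \<bullet> e)\<rfloor> = j e}" for n :: nat and j
  have cov: "E \<subseteq> (\<Union>j\<in>J n. U n j)" for n
  proof
    fix x assume x: "x \<in> E"
    let ?j = "restrict (\<lambda>e. \<lfloor>real n * (x \<bullet> e)\<rfloor>) B"
    have "\<lfloor>real n * (x \<bullet> e)\<rfloor> \<in> {- int n..int n}" if "e \<in> B" for e
    proof -
      have "\<bar>x \<bullet> e\<bar> \<le> 1"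
        using Cauchy_Schwarz_ineq2[of x e] E1[OF x] B(3)[OF that] by simp
      then have "\<bar>real n * (x \<bullet> e)\<bar> \<le> real n" by (simp add: abs_mult mult_left_le)
      then show ?thesis by (auto simp: le_floor_iff floor_le_iff abs_le_iff)
    qed
    then have "?j \<in> J n" by (auto simp: J_def)
    moreover have "x \<in> U n ?j" using x by (auto simp: U_def)
    ultimately show "x \<in> (\<Union>j\<in>J n. U n j)" by blast
  qed
  have diam: "norm (x - y) \<le> 2 * real k / real n"
    if "n > 0" "x \<in> U n j" "y \<in> U n j" for n j x y
  proof -
    have xy: "x \<in> E" "y \<in> E" using that by (auto simp: U_def)
    have "\<bar>(x - y) \<bullet> e\<bar> \<le> 1 / real n" if "e \<in> B" for e
    proof -
      have "\<lfloor>real n * (x \<bullet> e)\<rfloor> = \<lfloor>real n * (y \<bullet> e)\<rfloor>"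
        using \<open>x \<in> U n j\<close> \<open>y \<in> U n j\<close> that by (auto simp: U_def)
      then have "\<bar>real n * (x \<bullet> e) - real n * (y \<bullet> e)\<bar> \<le> 1" by linarith
      moreover have "real n * (x \<bullet> e) - real n * (y \<bullet> e) = real n * ((x - y) \<bullet> e)"
        by (simp add: inner_diff_left algebra_simps)
      ultimately show ?thesis using \<open>n > 0\<close> by (simp add: abs_mult field_simps)
    qed
    then have "(\<Sum>e\<in>B. \<bar>(x - y) \<bullet> e\<bar>) \<le> real k / real n"
      using sum_bounded_above[of B "\<lambda>e. \<bar>(x - y) \<bullet> e\<bar>" "1 / real n"] by (simp add: cardB)
    then show ?thesis using expand[of "x - y"] thin[OF xy] by (simp add: field_simps)
  qed
  have bd: "hausdorff_approx s \<delta> E \<le> ennreal (real ((2*n+1)^k) * (2 * real k / real n) powr s)"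
    if n: "n > 0" "2 * real k / real n \<le> \<delta>" for n \<delta>
  proof -
    have bnd: "bounded (U n j)" for j
      using E1 by (intro boundedI[of _ 1]) (auto simp: U_def)
    have dia: "diameter (U n j) \<le> 2 * real k / real n" for j
      by (rule diameter_le) (use diam n in auto)
    have "hausdorff_approx s \<delta> E \<le> hausdorff_approx s (2 * real k / real n) E"
      unfolding hausdorff_approx_def using n(2) by (intro INF_superset_mono) (blast intro: order_trans)+
    also have "\<dots> \<le> ennreal (real (card (J n)) * (2 * real k / real n) powr s)"
      by (rule hausdorff_approx_finite_cover[OF _ cov])
        (use finB bnd dia s in \<open>auto simp: J_def intro!: finite_PiE\<close>)
    also have "card (J n) = (2*n+1)^k"
    proof -
      have "card {- int n..int n} = 2 * n + 1" by simp
      then show ?thesis by (simp add: J_def card_PiE finB cardB del: card_atLeastAtMost_int)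
    qed
    finally show ?thesis .
  qed
  have lim: "(\<lambda>n. real ((2*n+1)^k) * (2 * real k / real n) powr s) \<longlonglongrightarrow> 0"
  proof (rule tendsto_sandwich[where f = "\<lambda>_. 0"])
    have sk: "real k < s" using s dim by (simp add: k_def)
    show "(\<lambda>n. 3^k * (2 * real k) powr s * real n powr (real k - s)) \<longlonglongrightarrow> 0"
      using sk by (intro tendsto_mult_right_zero tendsto_neg_powr filterlim_real_sequentially) auto
    show "\<forall>\<^sub>F n in sequentially. real ((2*n+1)^k) * (2 * real k / real n) powr s
        \<le> 3^k * (2 * real k) powr s * real n powr (real k - s)"
    proof (rule eventually_sequentiallyI[of 1])
      fix n :: nat assume n: "1 \<le> n"
      have "real ((2*n+1)^k) \<le> (3 * real n)^k"
        using n unfolding of_nat_power by (intro power_mono) auto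
      also have "\<dots> = 3^k * real n powr real k"
        using n by (simp add: power_mult_distrib powr_realpow)
      finally have "real ((2*n+1)^k) * (2 * real k / real n) powr s \<le>
        (3^k * real n powr real k) * ((2 * real k) powr s / real n powr s)"
        by (intro mult_mono) (auto simp: powr_divide)
      also have "\<dots> = 3^k * (2 * real k) powr s * real n powr (real k - s)"
        by (simp add: powr_diff)
      finally show "real ((2*n+1)^k) * (2 * real k / real n) powr s
        \<le> 3^k * (2 * real k) powr s * real n powr (real k - s)" .
    qed
  qed auto
  show ?thesis unfolding hausdorff_outer_eq_0_iff
  proof (intro allI impI)
    fix \<delta> :: real assume "\<delta> > 0"
    have "\<forall>\<^sub>F n in sequentially. 2 * real k / real n < \<delta>"
      using \<open>\<delta> > 0\<close> by (intro order_tendstoD[OF lim_const_over_n])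
    moreover have "\<forall>\<^sub>F n in sequentially. n > (0::nat)" by (rule eventually_gt_at_top)
    ultimately have "\<forall>\<^sub>F n in sequentially.
        hausdorff_approx s \<delta> E \<le> ennreal (real ((2*n+1)^k) * (2 * real k / real n) powr s)"
      by eventually_elim (use bd in auto)
    moreover have "(\<lambda>n. ennreal (real ((2*n+1)^k) * (2 * real k / real n) powr s)) \<longlonglongrightarrow> ennreal 0"
      using lim by (rule tendsto_ennrealI)
    ultimately have "hausdorff_approx s \<delta> E \<le> ennreal 0"
      by (intro tendsto_lowerbound) auto
    then show "hausdorff_approx s \<delta> E = 0" by simp
  qed
qed

lemma hausdorff_dim_le:
  fixes A :: "'a::metric_space set"
  assumes "c \<ge> 0" "\<And>s. s > c \<Longrightarrow> hausdorff_outer s A = 0"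
  shows "hausdorff_dim A \<le> c"
proof (rule field_le_epsilon)
  fix e :: real assume "e > 0"
  then show "hausdorff_dim A \<le> c + e"
    unfolding hausdorff_dim_def using assms
    by (intro cInf_lower) (auto intro: bdd_belowI[of _ 0])
qed

text \<open>On the unit sphere, the radial direction supplies the first of the two normals.\<close>

lemma sphere_slice_null:
  fixes E :: "'a::euclidean_space set"
  assumes E: "E \<subseteq> sphere 0 1"
    and loc: "\<And>x. x \<in> E \<Longrightarrow> \<exists>b r. norm b = 1 \<and> x \<bullet> b = 0 \<and> r > 0 \<and>
      (\<forall>y\<in>E \<inter> ball x r. \<forall>z\<in>E \<inter> ball x r. \<bar>(y - z) \<bullet> b\<bar> \<le> norm (y - z) / 4)"
    and s: "s > real DIM('a) - 2" "s > 0" and dim: "DIM('a) \<ge> 2"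
  shows "hausdorff_outer s E = 0"
proof (rule hausdorff_null_locally)
  fix x assume x: "x \<in> E"
  obtain b r where b: "norm b = 1" "x \<bullet> b = 0" "r > 0"
    and r: "\<And>y z. y \<in> E \<inter> ball x r \<Longrightarrow> z \<in> E \<inter> ball x r \<Longrightarrow> \<bar>(y - z) \<bullet> b\<bar> \<le> norm (y - z) / 4"
    using loc[OF x] by blast
  define \<rho> where "\<rho> = min r (1/4)"
  have b4: "\<bar>(y - z) \<bullet> b\<bar> \<le> norm (y - z) / 4"
    if "y \<in> E \<inter> ball x \<rho>" "z \<in> E \<inter> ball x \<rho>" for y z
    using that by (intro r) (auto simp: \<rho>_def)
  have x4: "\<bar>(y - z) \<bullet> x\<bar> \<le> norm (y - z) / 4"
    if yz: "y \<in> E \<inter> ball x \<rho>" "z \<in> E \<inter> ball x \<rho>" for y z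
  proof -
    have "y \<bullet> y = 1" "z \<bullet> z = 1" using yz E by (auto simp: norm_eq_1 dist_norm)
    then have "(y - z) \<bullet> x = (y - z) \<bullet> (x - (1/2) *\<^sub>R (y + z))"
      by (simp add: inner_diff_left inner_diff_right inner_add_right inner_commute)
    also have "x - (1/2) *\<^sub>R (y + z) = (1/2) *\<^sub>R ((x - y) + (x - z))"
      by (simp add: algebra_simps flip: scaleR_left.add)
    also have "\<bar>(y - z) \<bullet> \<dots>\<bar> \<le> norm (y - z) * norm ((1/2) *\<^sub>R ((x - y) + (x - z)))"
      by (rule Cauchy_Schwarz_ineq2)
    also have "norm ((1/2) *\<^sub>R ((x - y) + (x - z))) \<le> 1/4"
      using yz norm_triangle_ineq[of "x - y" "x - z"] by (auto simp: \<rho>_def dist_norm)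
    finally show ?thesis by (simp add: mult_left_mono)
  qed
  have "E \<inter> ball x \<rho> \<subseteq> cball 0 1" "norm x = 1" using x E by (auto simp: dist_norm)
  then have "thin (E \<inter> ball x \<rho>)"
    unfolding thin_def using b(1,2) b4 x4
    by (intro conjI exI[where x = x] exI[where x = b] ballI) auto
  then show "\<exists>r>0. hausdorff_outer s (E \<inter> ball x r) = 0"
    using thin_null[OF _ s dim, of "E \<inter> ball x \<rho>"] b(3)
    by (intro exI[of _ \<rho>]) (auto simp: \<rho>_def)
qed

lemma hyperplane_slice_null:
  fixes u :: "'a::euclidean_space"
  assumes "u \<noteq> 0" "s > real DIM('a) - 2" "s > 0" "DIM('a) \<ge> 2"
  shows "hausdorff_outer s {x \<in> sphere 0 1. u \<bullet> x = 0} = 0"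
proof (rule sphere_slice_null[OF _ _ assms(2-4)])
  fix x assume x: "x \<in> {x \<in> sphere 0 1. u \<bullet> x = 0}"
  let ?b = "u /\<^sub>R norm u"
  have "y \<bullet> ?b = 0" if "u \<bullet> y = 0" for y using that by (simp add: inner_commute)
  then show "\<exists>b r. norm b = 1 \<and> x \<bullet> b = 0 \<and> r > 0 \<and>
      (\<forall>y\<in>{x \<in> sphere 0 1. u \<bullet> x = 0} \<inter> ball x r. \<forall>z\<in>{x \<in> sphere 0 1. u \<bullet> x = 0} \<inter> ball x r.
        \<bar>(y - z) \<bullet> b\<bar> \<le> norm (y - z) / 4)"
    using assms(1) x by (intro exI[of _ ?b] exI[of _ 1]) (auto simp: inner_diff_left)
qed auto

subsection \<open>Variation of the energy\<close>

abbreviation frame3_kernel :: "'a::euclidean_space \<Rightarrow> 'a \<Rightarrow> 'a \<Rightarrow> real" where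
  "frame3_kernel x y z \<equiv> \<bar>(x \<bullet> y) * (x \<bullet> z) * (y \<bullet> z)\<bar>"

lemma abs_inner_le_1: "norm x = 1 \<Longrightarrow> norm y = 1 \<Longrightarrow> \<bar>x \<bullet> y\<bar> \<le> 1"
  using Cauchy_Schwarz_ineq2[of x y] by simp

lemma frame3_kernel_le_1:
  "norm x = 1 \<Longrightarrow> norm y = 1 \<Longrightarrow> norm z = 1 \<Longrightarrow> frame3_kernel x y z \<le> 1"
  by (simp add: abs_mult abs_inner_le_1 mult_le_one)

locale weighted_frame = prob_space N for N :: "'b measure" +
  fixes X :: "'b \<Rightarrow> 'a::euclidean_space"
  assumes X_measurable [measurable]: "X \<in> borel_measurable N"
    and X_norm: "\<And>p. p \<in> space N \<Longrightarrow> norm (X p) = 1"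
begin

definition weight :: "('b \<Rightarrow> real) \<Rightarrow> bool" where
  "weight a \<longleftrightarrow> a \<in> borel_measurable N \<and> (\<exists>C. \<forall>p\<in>space N. \<bar>a p\<bar> \<le> C)"

definition T :: "('b \<Rightarrow> real) \<Rightarrow> ('b \<Rightarrow> real) \<Rightarrow> ('b \<Rightarrow> real) \<Rightarrow> real" where
  "T a b c = (\<integral>p. \<integral>q. \<integral>r. a p * b q * c r * frame3_kernel (X p) (X q) (X r) \<partial>N \<partial>N \<partial>N)"

lemma weight_measurable: "weight a \<Longrightarrow> a \<in> borel_measurable N"
  by (simp add: weight_def)

sublocale NN: pair_prob_space N N ..
sublocale NNN: pair_prob_space N "N \<Otimes>\<^sub>M N" ..

lemma T_bounded:
  assumes "weight a" "weight b" "weight c"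
  obtains C where "C \<ge> 0" "\<And>p q r. p \<in> space N \<Longrightarrow> q \<in> space N \<Longrightarrow> r \<in> space N \<Longrightarrow>
    \<bar>a p * b q * c r * frame3_kernel (X p) (X q) (X r)\<bar> \<le> C"
proof -
  obtain A B D where A: "\<And>p. p \<in> space N \<Longrightarrow> \<bar>a p\<bar> \<le> A" and B: "\<And>p. p \<in> space N \<Longrightarrow> \<bar>b p\<bar> \<le> B"
    and D: "\<And>p. p \<in> space N \<Longrightarrow> \<bar>c p\<bar> \<le> D"
    using assms unfolding weight_def by metis
  have nn: "A \<ge> 0" "B \<ge> 0" "D \<ge> 0"
    using A B D not_empty by (meson abs_ge_zero all_not_in_conv order_trans)+
  show thesis
  proof (rule that)
    fix p q r assume S: "p \<in> space N" "q \<in> space N" "r \<in> space N"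
    have "\<bar>a p * b q * c r * frame3_kernel (X p) (X q) (X r)\<bar>
        = \<bar>a p\<bar> * \<bar>b q\<bar> * \<bar>c r\<bar> * frame3_kernel (X p) (X q) (X r)" by (simp add: abs_mult)
    also have "\<dots> \<le> A * B * D * 1"
      using nn A[OF S(1)] B[OF S(2)] D[OF S(3)] frame3_kernel_le_1[of "X p" "X q" "X r"] S X_norm
      by (intro mult_mono) auto
    finally show "\<bar>a p * b q * c r * frame3_kernel (X p) (X q) (X r)\<bar> \<le> A * B * D" by simp
  qed (use nn in simp)
qed

lemma
  assumes w: "weight a" "weight b" "weight c"
  shows T_integrable: "integrable (N \<Otimes>\<^sub>M (N \<Otimes>\<^sub>M N))
      (\<lambda>(p, q, r). a p * b q * c r * frame3_kernel (X p) (X q) (X r))" (is ?th1)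
    and T_eq: "T a b c = (\<integral>(p, q, r). a p * b q * c r * frame3_kernel (X p) (X q) (X r)
      \<partial>(N \<Otimes>\<^sub>M (N \<Otimes>\<^sub>M N)))" (is ?th2)
    and T_swap12: "T a b c = T b a c" (is ?th3)
    and T_swap23: "T a b c = T a c b" (is ?th4)
proof -
  note [measurable] = w[THEN weight_measurable]
  let ?k = "\<lambda>p q r. a p * b q * c r * frame3_kernel (X p) (X q) (X r)"
  obtain C where C: "C \<ge> 0" "\<And>p q r. p \<in> space N \<Longrightarrow> q \<in> space N \<Longrightarrow> r \<in> space N \<Longrightarrow> \<bar>?k p q r\<bar> \<le> C"
    using T_bounded[OF w] by metis
  show 1: ?th1
    by (rule NNN.P.integrable_const_bound[of _ C]) (use C in \<open>auto simp: space_pair_measure\<close>)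
  have inner: "integrable (N \<Otimes>\<^sub>M N) (\<lambda>(q, r). ?k p q r)" if "p \<in> space N" for p
    by (rule NN.P.integrable_const_bound[of _ C]) (use C that in \<open>auto simp: space_pair_measure\<close>)
  have "(\<integral>(p, q, r). ?k p q r \<partial>(N \<Otimes>\<^sub>M (N \<Otimes>\<^sub>M N))) = (\<integral>p. (\<integral>(q, r). ?k p q r \<partial>(N \<Otimes>\<^sub>M N)) \<partial>N)"
    using NNN.integral_fst'[OF 1] by simp
  also have "\<dots> = (\<integral>p. \<integral>q. \<integral>r. ?k p q r \<partial>N \<partial>N \<partial>N)"
    using NN.integral_fst'[OF inner] by (intro Bochner_Integration.integral_cong) auto
  finally show ?th2 by (simp add: T_def)
  have "T a b c = (\<integral>p. \<integral>r. \<integral>q. ?k p q r \<partial>N \<partial>N \<partial>N)" unfolding T_def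
    by (rule Bochner_Integration.integral_cong[OF refl]) (rule NN.Fubini_integral[OF inner, symmetric])
  also have "\<dots> = T a c b" unfolding T_def
    by (intro Bochner_Integration.integral_cong refl) (simp add: inner_commute mult_ac)
  finally show ?th4 .
  have "integrable (N \<Otimes>\<^sub>M N) (\<lambda>(p, q). \<integral>r. ?k p q r \<partial>N)"
  proof (rule NN.P.integrable_const_bound[of _ C])
    show "AE x in N \<Otimes>\<^sub>M N. norm (case x of (p, q) \<Rightarrow> \<integral>r. ?k p q r \<partial>N) \<le> C"
    proof (rule AE_I2, clarsimp simp: space_pair_measure)
      fix p q assume "p \<in> space N" "q \<in> space N"
      then have b: "\<bar>?k p q r\<bar> \<le> C" if "r \<in> space N" for r using C(2) that by blast
      then have i: "integrable N (?k p q)"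
        by (intro integrable_const_bound[of _ C]) auto
      have "\<bar>\<integral>r. ?k p q r \<partial>N\<bar> \<le> (\<integral>r. \<bar>?k p q r\<bar> \<partial>N)" by (rule integral_abs_bound)
      also have "\<dots> \<le> C" using i b by (intro integral_le_const integrable_abs AE_I2)
      finally show "\<bar>\<integral>r. ?k p q r \<partial>N\<bar> \<le> C" .
    qed
  qed measurable
  then have "T a b c = (\<integral>q. \<integral>p. \<integral>r. ?k p q r \<partial>N \<partial>N \<partial>N)" unfolding T_def
    by (rule NN.Fubini_integral[symmetric])
  also have "\<dots> = T b a c" unfolding T_def
    by (intro Bochner_Integration.integral_cong refl) (simp add: inner_commute mult_ac)
  finally show ?th3 .
qed

lemma weight_affine: "weight w \<Longrightarrow> weight f \<Longrightarrow> weight (\<lambda>p. w p + t * f p)"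
proof -
  assume w: "weight w" "weight f"
  note [measurable] = w[THEN weight_measurable]
  obtain A B where "\<And>p. p \<in> space N \<Longrightarrow> \<bar>w p\<bar> \<le> A" "\<And>p. p \<in> space N \<Longrightarrow> \<bar>f p\<bar> \<le> B"
    using w unfolding weight_def by metis
  then have "\<bar>w p + t * f p\<bar> \<le> A + \<bar>t\<bar> * B" if "p \<in> space N" for p
    using that by (intro order_trans[OF abs_triangle_ineq] add_mono) (auto simp: abs_mult mult_left_mono)
  then show ?thesis unfolding weight_def by (intro conjI) (measurable, blast)
qed

lemma T_expand:
  assumes w: "weight w" "weight f"
  defines "g t \<equiv> (\<lambda>p. w p + t * f p)"
  shows "T (g t) (g t) (g t) = T w w w + 3 * t * T f w w + 3 * t\<^sup>2 * T f f w + t ^ 3 * T f f f"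
proof -
  define k where "k a b c = (\<lambda>(p, q, r). a p * b q * c r * frame3_kernel (X p) (X q) (X r))" for a b c
  let ?P = "N \<Otimes>\<^sub>M (N \<Otimes>\<^sub>M N)"
  have i: "integrable ?P (k a b c)" if "weight a" "weight b" "weight c" for a b c
    unfolding k_def by (rule T_integrable[OF that])
  have Tk: "T a b c = integral\<^sup>L ?P (k a b c)" if "weight a" "weight b" "weight c" for a b c
    unfolding k_def by (rule T_eq[OF that])
  have "weight (g t)" unfolding g_def by (rule weight_affine[OF w])
  moreover have "k (g t) (g t) (g t) = (\<lambda>x. k w w w x + t * (k w w f x + k w f w x + k f w w x)
      + t\<^sup>2 * (k f f w x + k f w f x + k w f f x) + t ^ 3 * k f f f x)"
    by (auto simp: k_def g_def fun_eq_iff algebra_simps power2_eq_square power3_eq_cube)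
  ultimately have *: "T (g t) (g t) (g t) = T w w w + t * (T w w f + T w f w + T f w w)
      + t\<^sup>2 * (T f f w + T f w f + T w f f) + t ^ 3 * T f f f"
    using i w by (simp add: Tk)
  have sw: "T w f w = T f w w" "T w f f = T f w f" "T w w f = T w f w" "T f w f = T f f w"
    by (intro T_swap12 T_swap23 w)+
  show ?thesis unfolding * sw by (simp add: algebra_simps)
qed

lemma
  assumes g: "weight g" "\<And>p. p \<in> space N \<Longrightarrow> g p \<ge> 0" "(\<integral>p. g p \<partial>N) = 1"
  defines "\<nu> \<equiv> distr (density N g) (restrict_space borel (sphere 0 1)) X"
  shows sphere_prob_weighted: "sphere_prob \<nu>"
    and frame3_energy_weighted: "frame3_energy \<nu> = T g g g"
proof -
  note [measurable] = g(1)[THEN weight_measurable]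
  have X [measurable]: "X \<in> measurable N (restrict_space borel (sphere 0 1))"
    using X_norm by (intro measurable_restrict_space2) auto
  have ig: "integrable N g" using g(3) not_integrable_integral_eq by force
  have "emeasure (density N g) (space N) = (\<integral>\<^sup>+p. g p \<partial>N)"
    by (subst emeasure_density) (auto intro!: nn_integral_cong)
  also have "\<dots> = 1" using ig g by (subst nn_integral_eq_integral) auto
  finally have "prob_space (density N g)" by (intro prob_spaceI) simp
  then have "prob_space \<nu>" unfolding \<nu>_def by (intro prob_space.prob_space_distr) auto
  then interpret \<nu>: prob_space \<nu> .
  show "sphere_prob \<nu>" using \<open>prob_space \<nu>\<close> by (simp add: sphere_prob_def \<nu>_def)
  have int: "(\<integral>x. h x \<partial>\<nu>) = (\<integral>p. g p * h (X p) \<partial>N)" if "h \<in> borel_measurable borel" for h :: "'a \<Rightarrow> real"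
  proof -
    note [measurable] = that
    have [measurable]: "h \<in> borel_measurable (restrict_space borel (sphere 0 1))"
      by (intro measurable_restrict_space1) simp
    have "(\<integral>x. h x \<partial>\<nu>) = (\<integral>p. h (X p) \<partial>density N g)"
      unfolding \<nu>_def by (intro integral_distr) auto
    also have "\<dots> = (\<integral>p. g p *\<^sub>R h (X p) \<partial>N)"
      using g by (intro integral_density) auto
    finally show ?thesis by simp
  qed
  have "(\<lambda>x. x) \<in> borel_measurable \<nu>"
    using measurable_restrict_space1[OF measurable_ident[of "borel :: 'a measure"], of "sphere 0 1"]
    by (simp add: \<nu>_def id_def)
  then have sndm: "(\<lambda>p. snd p) \<in> borel_measurable (borel \<Otimes>\<^sub>M \<nu>)"
    by (intro measurable_compose[OF measurable_snd])
  have "(\<integral>y. \<integral>z. frame3_kernel x y z \<partial>\<nu> \<partial>\<nu>) = (\<integral>q. g q * (\<integral>r. g r * frame3_kernel x (X q) (X r) \<partial>N) \<partial>N)" for x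
  proof -
    have m: "(\<lambda>y. \<integral>z. frame3_kernel x y z \<partial>\<nu>) \<in> borel_measurable borel"
      by (rule \<nu>.borel_measurable_lebesgue_integral)
        (unfold split_beta, intro borel_measurable_abs borel_measurable_times borel_measurable_inner
          sndm measurable_fst measurable_const, auto)
    show ?thesis by (subst int[OF m]) (subst int, auto)
  qed
  then have "frame3_energy \<nu> =
      (\<integral>x. (\<integral>q. g q * (\<integral>r. g r * frame3_kernel x (X q) (X r) \<partial>N) \<partial>N) \<partial>\<nu>)"
    by (simp add: frame3_energy_def)
  also have "\<dots> = (\<integral>p. g p * (\<integral>q. g q * (\<integral>r. g r * frame3_kernel (X p) (X q) (X r) \<partial>N) \<partial>N) \<partial>N)"
    by (rule int) measurable
  also have "\<dots> = T g g g"
    unfolding T_def by (simp only: mult.assoc Bochner_Integration.integral_mult_right_zero)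
  finally show "frame3_energy \<nu> = T g g g" .
qed

end

lemma cubic_nonneg_coeffs:
  fixes a b c :: real
  assumes "t0 > 0" and nn: "\<And>t. 0 < t \<Longrightarrow> t < t0 \<Longrightarrow> 0 \<le> 3 * t * a + 3 * t\<^sup>2 * b + t ^ 3 * c"
  shows "a \<ge> 0" and "a = 0 \<Longrightarrow> b \<ge> 0"
proof -
  have ev: "\<forall>\<^sub>F t in at_right (0::real). 0 < t \<and> t < t0"
    using assms(1) by (auto simp: eventually_at_right_field)
  have "((\<lambda>t. 3 * a + 3 * t * b + t\<^sup>2 * c) \<longlongrightarrow> 3 * a + 3 * 0 * b + 0\<^sup>2 * c) (at_right 0)"
    by (intro tendsto_intros)
  moreover have "\<forall>\<^sub>F t in at_right 0. 0 \<le> 3 * a + 3 * t * b + t\<^sup>2 * c"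
    using ev
  proof eventually_elim
    case (elim t)
    have "0 \<le> t * (3 * a + 3 * t * b + t\<^sup>2 * c)"
      using nn[of t] elim by (simp add: algebra_simps power2_eq_square power3_eq_cube)
    then show ?case using elim by (simp add: zero_le_mult_iff)
  qed
  ultimately show "a \<ge> 0" using tendsto_lowerbound[of "\<lambda>t. 3 * a + 3 * t * b + t\<^sup>2 * c" "3*a" "at_right 0" 0] by simp
  assume "a = 0"
  have "((\<lambda>t. 3 * b + t * c) \<longlongrightarrow> 3 * b + 0 * c) (at_right 0)"
    by (intro tendsto_intros)
  moreover have "\<forall>\<^sub>F t in at_right 0. 0 \<le> 3 * b + t * c"
    using ev
  proof eventually_elim
    case (elim t)
    have "0 \<le> t\<^sup>2 * (3 * b + t * c)"
      using nn[of t] elim \<open>a = 0\<close> by (simp add: algebra_simps power2_eq_square power3_eq_cube)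
    then show ?case using elim by (simp add: zero_le_mult_iff)
  qed
  ultimately show "b \<ge> 0" using tendsto_lowerbound[of "\<lambda>t. 3 * b + t * c" "3*b" "at_right 0" 0] by simp
qed

subsection \<open>The potential of a minimizer\<close>

lemma continuous_on_bounded:
  fixes f :: "'c::topological_space \<Rightarrow> 'b::real_normed_vector"
  assumes "compact P" "continuous_on P f"
  obtains C where "C \<ge> 0" "\<And>x. x \<in> P \<Longrightarrow> norm (f x) \<le> C"
proof -
  have "bounded (f ` P)" using assms by (intro compact_imp_bounded compact_continuous_image)
  then show thesis using that by (auto simp: bounded_pos) (metis less_imp_le)
qed

locale sphere_measure = prob_space M for M :: "'a::euclidean_space measure" +
  assumes sets_M: "sets M = sets (restrict_space borel (sphere (0::'a) 1))"
begin

abbreviation Sph :: "'a set" where "Sph \<equiv> sphere 0 1"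
abbreviation S :: "'a set" where "S \<equiv> msupport M"

lemma space_M: "space M = Sph"
  using sets_eq_imp_space_eq[OF sets_M] by (simp add: space_restrict_space)

lemma borel_measurable_M_iff: "f \<in> borel_measurable M \<longleftrightarrow> f \<in> borel_measurable (restrict_space borel Sph)"
  using measurable_cong_sets[OF sets_M refl] by blast

lemma measurable_ident_M: "(\<lambda>x. x) \<in> borel_measurable M"
  unfolding borel_measurable_M_iff by (rule measurable_restrict_space1) simp

lemma continuous_on_measurable:
  fixes f :: "'a \<Rightarrow> 'b::topological_space"
  shows "continuous_on Sph f \<Longrightarrow> f \<in> borel_measurable M"
  unfolding borel_measurable_M_iff by (rule borel_measurable_continuous_on_restrict)

lemma continuous_on_integrable:
  fixes f :: "'a \<Rightarrow> 'b::euclidean_space"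
  assumes "continuous_on Sph f" shows "integrable M f"
proof -
  obtain C where "\<And>x. x \<in> Sph \<Longrightarrow> norm (f x) \<le> C"
    using continuous_on_bounded[OF compact_sphere assms] by metis
  then show ?thesis
    by (intro integrable_const_bound[of _ C] AE_I2 continuous_on_measurable assms) (auto simp: space_M)
qed

lemma continuous_on_measurable_pair:
  fixes f :: "'a \<times> 'a \<Rightarrow> 'b::topological_space"
  assumes "continuous_on (Sph \<times> Sph) f" shows "f \<in> borel_measurable (M \<Otimes>\<^sub>M M)"
proof -
  have "(\<lambda>p. (fst p, snd p)) \<in> (M \<Otimes>\<^sub>M M) \<rightarrow>\<^sub>M (borel \<Otimes>\<^sub>M borel)"
    by (intro measurable_Pair measurable_compose[OF measurable_fst measurable_ident_M]
        measurable_compose[OF measurable_snd measurable_ident_M])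
  then have "(\<lambda>p. p) \<in> (M \<Otimes>\<^sub>M M) \<rightarrow>\<^sub>M borel" by (simp add: borel_prod)
  then have "(\<lambda>p. p) \<in> (M \<Otimes>\<^sub>M M) \<rightarrow>\<^sub>M restrict_space borel (Sph \<times> Sph)"
    by (intro measurable_restrict_space2) (auto simp: space_pair_measure space_M)
  from measurable_compose[OF this borel_measurable_continuous_on_restrict[OF assms]]
  show ?thesis by simp
qed

lemma continuous_on_integral:
  fixes h :: "'c::metric_space \<Rightarrow> 'a \<Rightarrow> real"
  assumes P: "compact P" and h: "continuous_on (P \<times> Sph) (\<lambda>(p, y). h p y)"
  shows "continuous_on P (\<lambda>p. \<integral>y. h p y \<partial>M)"
  unfolding continuous_on_sequentially comp_def
proof (intro allI ballI impI, elim conjE)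
  fix x a assume a: "a \<in> P" "\<forall>n. x n \<in> P" "x \<longlonglongrightarrow> a"
  obtain C where C': "\<And>q. q \<in> P \<times> Sph \<Longrightarrow> norm (case q of (p, y) \<Rightarrow> h p y) \<le> C"
    using continuous_on_bounded[OF compact_Times[OF P compact_sphere] h] by blast
  have C: "\<bar>h p y\<bar> \<le> C" if "p \<in> P" "y \<in> Sph" for p y
    using C'[of "(p, y)"] that by simp
  have sec: "continuous_on Sph (h p)" if "p \<in> P" for p
    using continuous_on_compose2[OF h, of Sph "\<lambda>y. (p, y)"] that by (simp add: continuous_on_Pair image_subset_iff)
  show "(\<lambda>n. \<integral>y. h (x n) y \<partial>M) \<longlonglongrightarrow> (\<integral>y. h a y \<partial>M)"
  proof (rule integral_dominated_convergence[where w = "\<lambda>_. C"])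
    show "AE y in M. (\<lambda>n. h (x n) y) \<longlonglongrightarrow> h a y"
    proof (rule AE_I2)
      fix y assume "y \<in> space M"
      then have "continuous_on P (\<lambda>p. h p y)"
        using continuous_on_compose2[OF h, of P "\<lambda>p. (p, y)"] by (simp add: continuous_on_Pair image_subset_iff space_M)
      then show "(\<lambda>n. h (x n) y) \<longlonglongrightarrow> h a y"
        using a by (auto simp: continuous_on_sequentially comp_def)
    qed
  qed (use a sec C in \<open>auto intro!: continuous_on_measurable simp: space_M\<close>)
qed

lemma msupport_subset: "S \<subseteq> Sph"
  by (auto simp: msupport_def space_M)

lemma msupport_pos: "x \<in> S \<Longrightarrow> e > 0 \<Longrightarrow> emeasure M (ball x e \<inter> Sph) > 0"
  unfolding msupport_def space_M by blast

lemma not_msupportD: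
  assumes "x \<in> Sph" "x \<notin> S"
  obtains e where "e > 0" "emeasure M (ball x e \<inter> Sph) = 0"
  using assms by (auto simp: msupport_def space_M not_less)

lemma ball_sets: "U \<in> sets borel \<Longrightarrow> U \<inter> Sph \<in> sets M"
  unfolding sets_M by (auto simp: sets_restrict_space)

lemma compact_msupport: "compact S"
proof -
  have "closed S"
    unfolding closed_sequential_limits
  proof (intro allI impI, elim conjE)
    fix x l assume x: "\<forall>n. x n \<in> S" "x \<longlonglongrightarrow> l"
    have "closed Sph" by simp
    then have l: "l \<in> Sph"
      using x msupport_subset closed_sequentially by (metis subsetD)
    show "l \<in> S"
    proof (rule ccontr)
      assume "l \<notin> S"
      then obtain e where e: "e > 0" "emeasure M (ball l e \<inter> Sph) = 0"
        using not_msupportD[OF l] by metis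
      have "\<exists>n. dist (x n) l < e / 2"
        using metric_LIMSEQ_D[OF x(2), of "e / 2"] e(1) by auto
      then obtain n where n: "dist (x n) l < e / 2" ..
      have "ball (x n) (e/2) \<inter> Sph \<subseteq> ball l e \<inter> Sph"
      proof
        fix y assume "y \<in> ball (x n) (e/2) \<inter> Sph"
        then show "y \<in> ball l e \<inter> Sph" using n dist_triangle[of l y "x n"] by (simp add: dist_commute)
      qed
      then have "emeasure M (ball (x n) (e/2) \<inter> Sph) \<le> 0"
        using e(2) emeasure_mono[of _ "ball l e \<inter> Sph" M] ball_sets[of "ball l e"] by fastforce
      moreover have "0 < emeasure M (ball (x n) (e/2) \<inter> Sph)"
        using x(1) e(1) by (intro msupport_pos) auto
      ultimately show False by simp
    qed
  qed
  then have "compact (Sph \<inter> S)" by (intro compact_Int_closed) auto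
  then show ?thesis using msupport_subset by (simp add: inf_absorb2)
qed

lemma AE_msupport: "AE x in M. x \<in> S"
proof -
  define \<F> where "\<F> = {U. open U \<and> emeasure M (U \<inter> Sph) = 0}"
  obtain \<F>' where F': "\<F>' \<subseteq> \<F>" "countable \<F>'" "\<Union>\<F>' = \<Union>\<F>"
    using Lindelof[of \<F>] by (auto simp: \<F>_def)
  have "(\<Union>U\<in>\<F>'. U \<inter> Sph) \<in> null_sets M"
    using F' by (intro null_sets_UN') (auto simp: \<F>_def null_sets_def intro!: ball_sets)
  moreover have "{x \<in> space M. x \<notin> S} \<subseteq> (\<Union>U\<in>\<F>'. U \<inter> Sph)"
  proof
    fix x assume "x \<in> {x \<in> space M. x \<notin> S}"
    then have x: "x \<in> Sph" "x \<notin> S" by (auto simp: space_M)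
    then obtain e where "e > 0" "emeasure M (ball x e \<inter> Sph) = 0" using not_msupportD by metis
    then have "x \<in> \<Union>\<F>" by (auto simp: \<F>_def intro!: exI[of _ "ball x e"])
    then show "x \<in> (\<Union>U\<in>\<F>'. U \<inter> Sph)" using F'(3) x by blast
  qed
  ultimately show ?thesis by (rule AE_I')
qed

lemma integral_cong_msupport:
  "(\<And>x. x \<in> S \<Longrightarrow> f x = g x) \<Longrightarrow> f \<in> borel_measurable M \<Longrightarrow> g \<in> borel_measurable M \<Longrightarrow>
    (\<integral>x. f x \<partial>M) = (\<integral>x. (g x :: real) \<partial>M)"
  using AE_msupport by (intro integral_cong_AE) auto

lemma zero_on_msupport:
  fixes g :: "'a \<Rightarrow> real"
  assumes g: "continuous_on Sph g" and nn: "\<And>x. x \<in> S \<Longrightarrow> g x \<ge> 0" and "(\<integral>x. g x \<partial>M) = 0" and x: "x \<in> S"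
  shows "g x = 0"
proof (rule ccontr)
  assume "g x \<noteq> 0"
  then have pos: "g x > 0" using nn[OF x] by simp
  have "AE x in M. g x \<ge> 0" using AE_msupport nn by auto
  then have "AE x in M. g x = 0"
    using assms(3) integral_nonneg_eq_0_iff_AE[OF continuous_on_integrable[OF g]] by simp
  then have ae: "AE y in M. \<not> (g y > 0)" by auto
  have xS: "x \<in> Sph" using x msupport_subset by blast
  obtain e where e: "e > 0" "\<And>y. y \<in> Sph \<Longrightarrow> dist y x < e \<Longrightarrow> dist (g y) (g x) < g x"
    using g xS pos unfolding continuous_on_iff by metis
  have sets: "{y \<in> space M. g y > 0} \<in> sets M"
    using continuous_on_measurable[OF g] by measurable
  have "emeasure M {y \<in> space M. g y > 0} = 0"
    using AE_iff_measurable[OF sets, of "\<lambda>y. \<not> (g y > 0)"] ae by simp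
  moreover have "ball x e \<inter> Sph \<subseteq> {y \<in> space M. g y > 0}"
  proof
    fix y assume "y \<in> ball x e \<inter> Sph"
    then have "dist (g y) (g x) < g x" "y \<in> space M" using e(2)[of y] by (auto simp: space_M dist_commute)
    then show "y \<in> {y \<in> space M. g y > 0}" by (simp add: dist_real_def)
  qed
  ultimately have "emeasure M (ball x e \<inter> Sph) \<le> 0"
    using emeasure_mono[OF _ sets] by metis
  then show False using msupport_pos[OF x e(1)] by simp
qed

definition F :: "'a \<Rightarrow> real" where "F v = (\<integral>y. \<integral>z. frame3_kernel v y z \<partial>M \<partial>M)"
definition H :: "'a \<Rightarrow> 'a \<Rightarrow> real" where "H x y = (\<integral>z. \<bar>x \<bullet> z\<bar> * \<bar>y \<bullet> z\<bar> \<partial>M)"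
definition G :: "'a \<Rightarrow> 'a \<Rightarrow> real" where "G x y = \<bar>x \<bullet> y\<bar> * H x y"

lemma G_eq: "(\<integral>z. frame3_kernel x y z \<partial>M) = G x y"
proof -
  have "frame3_kernel x y z = \<bar>x \<bullet> y\<bar> * (\<bar>x \<bullet> z\<bar> * \<bar>y \<bullet> z\<bar>)" for z by (simp add: abs_mult)
  then show ?thesis unfolding G_def H_def by (simp only: Bochner_Integration.integral_mult_right_zero)
qed

lemma F_eq: "F v = (\<integral>y. G v y \<partial>M)"
  by (simp add: F_def G_eq)

lemma energy_eq: "frame3_energy M = (\<integral>x. F x \<partial>M)"
  by (simp add: frame3_energy_def F_def)

lemma continuous_on_H: "continuous_on (Sph \<times> Sph) (\<lambda>(x, y). H x y)"
proof -
  have "continuous_on ((Sph \<times> Sph) \<times> Sph) (\<lambda>(p, z). \<bar>fst p \<bullet> z\<bar> * \<bar>snd p \<bullet> z\<bar>)"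
    unfolding split_beta by (intro continuous_intros)
  from continuous_on_integral[OF _ this] show ?thesis
    by (simp add: H_def split_beta compact_Times)
qed

lemma continuous_on_G: "continuous_on (Sph \<times> Sph) (\<lambda>(x, y). G x y)"
  using continuous_on_H unfolding G_def split_beta by (intro continuous_intros) auto

lemma continuous_on_G_section: "x \<in> Sph \<Longrightarrow> continuous_on Sph (G x)"
  using continuous_on_compose2[OF continuous_on_G, of Sph "\<lambda>y. (x, y)"]
  by (simp add: image_subset_iff continuous_on_Pair)

lemma continuous_on_F: "continuous_on Sph F"
  unfolding F_eq[abs_def] by (rule continuous_on_integral[OF compact_sphere continuous_on_G])

end

locale frame3_minimizer = sphere_measure M for M :: "'a::euclidean_space measure" +
  assumes minimal: "\<And>\<nu> :: 'a measure. sphere_prob \<nu> \<Longrightarrow> frame3_energy M \<le> frame3_energy \<nu>"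
begin

abbreviation I :: real where "I \<equiv> frame3_energy M"

text \<open>The competitor is \<open>(1 - t) M + t \<delta>\<^sub>v\<close>, realised as the image of a weighted measure on
  \<open>bool \<times> Sph\<close>.\<close>

lemma F_ge:
  assumes v: "norm v = 1" shows "I \<le> F v"
proof -
  let ?B = "measure_pmf (bernoulli_pmf (1/2))"
  define N where "N = ?B \<Otimes>\<^sub>M M"
  define X where "X = (\<lambda>p::bool \<times> 'a. if fst p then v else snd p)"
  define c where "c \<alpha> \<beta> = (\<lambda>p::bool \<times> 'a. if fst p then \<alpha> else \<beta>)" for \<alpha> \<beta> :: real
  interpret BM: pair_prob_space ?B M ..
  have fst [measurable]: "fst \<in> N \<rightarrow>\<^sub>M count_space UNIV"
    unfolding N_def using measurable_fst[of ?B M] by simp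
  have snd [measurable]: "snd \<in> borel_measurable N"
    unfolding N_def using measurable_compose[OF measurable_snd measurable_ident_M] by blast
  have spN: "space N = UNIV \<times> Sph" by (simp add: N_def space_pair_measure space_M)
  have Xm [measurable]: "X \<in> borel_measurable N" unfolding X_def by measurable
  have cm [measurable]: "c \<alpha> \<beta> \<in> borel_measurable N" for \<alpha> \<beta> unfolding c_def by measurable
  interpret W: weighted_frame N X
  proof (intro weighted_frame.intro weighted_frame_axioms.intro Xm)
    show "prob_space N" unfolding N_def by unfold_locales
  qed (use v in \<open>auto simp: X_def spN\<close>)
  have XM: "X \<in> N \<rightarrow>\<^sub>M M"
    using measurable_restrict_space2[of X N Sph borel] W.X_norm measurable_cong_sets[OF refl sets_M] by auto
  have mix: "(\<integral>p. c \<alpha> \<beta> p * h (X p) \<partial>N) = (\<alpha> * h v + \<beta> * (\<integral>z. h z \<partial>M)) / 2"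
    if h: "continuous_on Sph h" for h \<alpha> \<beta>
  proof -
    obtain C where C: "C \<ge> 0" "\<And>x. x \<in> Sph \<Longrightarrow> \<bar>h x\<bar> \<le> C"
      using continuous_on_bounded[OF compact_sphere h] by (metis real_norm_def)
    have hm: "(\<lambda>p. h (X p)) \<in> borel_measurable N"
      by (rule measurable_compose[OF XM continuous_on_measurable[OF h]])
    have "integrable N (\<lambda>p. c \<alpha> \<beta> p * h (X p))"
    proof (rule W.integrable_const_bound[of _ "(\<bar>\<alpha>\<bar> + \<bar>\<beta>\<bar>) * C"])
      show "AE p in N. norm (c \<alpha> \<beta> p * h (X p)) \<le> (\<bar>\<alpha>\<bar> + \<bar>\<beta>\<bar>) * C"
      proof (rule AE_I2)
        fix p assume "p \<in> space N"
        then have "\<bar>h (X p)\<bar> \<le> C" using C(2)[of "X p"] W.X_norm by auto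
        then have "\<bar>c \<alpha> \<beta> p\<bar> * \<bar>h (X p)\<bar> \<le> (\<bar>\<alpha>\<bar> + \<bar>\<beta>\<bar>) * C"
          by (intro mult_mono) (auto simp: c_def)
        then show "norm (c \<alpha> \<beta> p * h (X p)) \<le> (\<bar>\<alpha>\<bar> + \<bar>\<beta>\<bar>) * C" by (simp add: abs_mult)
      qed
    qed (use hm in measurable)
    from BM.integral_fst'[OF this[unfolded N_def]]
    have "(\<integral>p. c \<alpha> \<beta> p * h (X p) \<partial>N) = (\<integral>b. \<integral>z. c \<alpha> \<beta> (b, z) * h (X (b, z)) \<partial>M \<partial>?B)"
      by (simp add: N_def)
    also have "\<dots> = (\<alpha> * h v + \<beta> * (\<integral>z. h z \<partial>M)) / 2"
      by (simp add: c_def X_def prob_space add_divide_distrib)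
    finally show ?thesis .
  qed
  define w where "w = c 0 2"
  define f where "f = c 2 (-2)"
  have wt: "W.weight (c \<alpha> \<beta>)" for \<alpha> \<beta>
    unfolding W.weight_def by (intro conjI cm exI[of _ "\<bar>\<alpha>\<bar> + \<bar>\<beta>\<bar>"]) (auto simp: c_def)
  have F_w: "(\<integral>q. w q * (\<integral>r. w r * frame3_kernel x (X q) (X r) \<partial>N) \<partial>N) = F x" if x: "x \<in> Sph" for x
  proof -
    have "(\<integral>r. w r * frame3_kernel x y (X r) \<partial>N) = G x y" for y
      unfolding w_def by (subst mix) (auto intro!: continuous_intros simp: G_eq)
    then show ?thesis
      unfolding w_def by (simp add: mix[OF continuous_on_G_section[OF x]] F_eq)
  qed
  have T: "W.T (c \<alpha> \<beta>) w w = (\<alpha> * F v + \<beta> * I) / 2" for \<alpha> \<beta>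
  proof -
    have "W.T (c \<alpha> \<beta>) w w = (\<integral>p. c \<alpha> \<beta> p * (\<integral>q. w q * (\<integral>r. w r * frame3_kernel (X p) (X q) (X r) \<partial>N) \<partial>N) \<partial>N)"
      unfolding W.T_def by (simp only: mult.assoc Bochner_Integration.integral_mult_right_zero)
    also have "\<dots> = (\<integral>p. c \<alpha> \<beta> p * F (X p) \<partial>N)"
      using W.X_norm by (intro Bochner_Integration.integral_cong refl) (subst F_w, auto)
    finally show ?thesis by (simp add: mix[OF continuous_on_F] energy_eq)
  qed
  have "0 \<le> 3 * t * W.T f w w + 3 * t\<^sup>2 * W.T f f w + t ^ 3 * W.T f f f" if t: "0 < t" "t < 1" for t
  proof -
    define g where "g = c (2 * t) (2 - 2 * t)"
    have g: "g = (\<lambda>p. w p + t * f p)" by (auto simp: g_def w_def f_def c_def fun_eq_iff)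
    have wg: "W.weight g" unfolding g_def by (rule wt)
    have g1: "(\<integral>p. g p \<partial>N) = 1"
      using mix[of "\<lambda>_. 1" "2 * t" "2 - 2 * t"] by (simp add: g_def prob_space)
    have g0: "g p \<ge> 0" for p using t by (auto simp: g_def c_def)
    have "I \<le> W.T g g g"
      using minimal[OF W.sphere_prob_weighted[OF wg g0 g1]] W.frame3_energy_weighted[OF wg g0 g1] by simp
    also have "\<dots> = W.T w w w + 3 * t * W.T f w w + 3 * t\<^sup>2 * W.T f f w + t ^ 3 * W.T f f f"
      unfolding g by (rule W.T_expand) (auto simp: w_def f_def wt)
    also have "W.T w w w = I" using T[of 0 2] by (simp add: w_def)
    finally show ?thesis by simp
  qed
  then have "W.T f w w \<ge> 0" by (rule cubic_nonneg_coeffs(1)[OF zero_less_one])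
  then show ?thesis using T[of 2 "-2"] by (simp add: f_def)
qed

lemma F_eq_I:
  assumes "x \<in> S" shows "F x = I"
proof -
  have "F x - I = 0"
  proof (rule zero_on_msupport[OF _ _ _ assms])
    show "continuous_on Sph (\<lambda>x. F x - I)" by (intro continuous_intros continuous_on_F)
    show "0 \<le> F x - I" if "x \<in> S" for x using F_ge[of x] that msupport_subset by auto
    show "(\<integral>x. F x - I \<partial>M) = 0"
      using continuous_on_integrable[OF continuous_on_F] by (simp add: energy_eq prob_space)
  qed
  then show ?thesis by simp
qed

lemma second_order:
  assumes f: "f \<in> borel_measurable M" and C: "\<And>x. x \<in> Sph \<Longrightarrow> \<bar>f x\<bar> \<le> C" and 0: "(\<integral>x. f x \<partial>M) = 0"
  shows "0 \<le> (\<integral>x. f x * (\<integral>y. f y * G x y \<partial>M) \<partial>M)"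
proof -
  interpret W: weighted_frame M "\<lambda>x. x"
    by unfold_locales (auto simp: measurable_ident_M space_M)
  have wf: "W.weight f" "W.weight (\<lambda>_. 1)"
    unfolding W.weight_def space_M using f C by (blast, auto)
  have intf: "integrable M f" using f C by (intro integrable_const_bound[of _ C]) (auto simp: space_M)
  have T1: "W.T f (\<lambda>_. 1) (\<lambda>_. 1) = 0"
  proof -
    have "W.T f (\<lambda>_. 1) (\<lambda>_. 1) = (\<integral>x. f x * F x \<partial>M)"
      unfolding W.T_def F_def by (simp only: mult.assoc mult_1 Bochner_Integration.integral_mult_right_zero)
    also have "\<dots> = (\<integral>x. f x * I \<partial>M)"
      using continuous_on_measurable[OF continuous_on_F] f
      by (intro integral_cong_msupport) (auto simp: F_eq_I)
    finally show ?thesis using 0 by simp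
  qed
  have T0: "W.T (\<lambda>_. 1) (\<lambda>_. 1) (\<lambda>_. 1) = I" by (simp add: W.T_def frame3_energy_def)
  have T2: "W.T f f (\<lambda>_. 1) = (\<integral>x. f x * (\<integral>y. f y * G x y \<partial>M) \<partial>M)"
    unfolding W.T_def G_eq[symmetric]
    by (simp only: mult.assoc mult_1 Bochner_Integration.integral_mult_right_zero)
  define D where "D = max C 1"
  have D: "D \<ge> 1" "\<And>x. x \<in> Sph \<Longrightarrow> \<bar>f x\<bar> \<le> D" using C by (auto simp: D_def le_max_iff_disj)
  have "0 \<le> 3 * t * W.T f (\<lambda>_. 1) (\<lambda>_. 1) + 3 * t\<^sup>2 * W.T f f (\<lambda>_. 1) + t ^ 3 * W.T f f f"
    if t: "0 < t" "t < 1 / D" for t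
  proof -
    define g where "g = (\<lambda>x. 1 + t * f x)"
    have wg: "W.weight g" unfolding g_def by (rule W.weight_affine[OF wf(2,1)])
    have g1: "(\<integral>x. g x \<partial>M) = 1" using intf 0 by (simp add: g_def prob_space)
    have g0: "g x \<ge> 0" if "x \<in> space M" for x
    proof -
      have "t * \<bar>f x\<bar> \<le> 1 / D * D" using t D that by (intro mult_mono) (auto simp: space_M)
      then have "\<bar>t * f x\<bar> \<le> 1" using t D by (simp add: abs_mult)
      then show ?thesis by (simp add: g_def)
    qed
    have "I \<le> W.T g g g"
      using minimal[OF W.sphere_prob_weighted[OF wg g0 g1]] W.frame3_energy_weighted[OF wg g0 g1] by simp
    also have "\<dots> = I + 3 * t * W.T f (\<lambda>_. 1) (\<lambda>_. 1) + 3 * t\<^sup>2 * W.T f f (\<lambda>_. 1) + t ^ 3 * W.T f f f"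
      unfolding g_def T0[symmetric] by (rule W.T_expand[OF wf(2,1)])
    finally show ?thesis by simp
  qed
  moreover have "0 < 1 / D" using D(1) by simp
  ultimately have "W.T f f (\<lambda>_. 1) \<ge> 0"
    using cubic_nonneg_coeffs(2)[of "1 / D"] T1 by blast
  then show ?thesis using T2 by simp
qed

end

subsection \<open>Conditional positivity\<close>

context frame3_minimizer
begin

lemma integral_ball_close:
  assumes h: "h \<in> borel_measurable M" and e: "\<And>p. p \<in> ball a r \<inter> Sph \<Longrightarrow> \<bar>h p - k\<bar> \<le> e" "e \<ge> 0"
    and m: "measure M (ball a r \<inter> Sph) > 0"
  shows "\<bar>(\<integral>p. indicator (ball a r) p / measure M (ball a r \<inter> Sph) * h p \<partial>M) - k\<bar> \<le> e"
proof -
  let ?B = "ball a r \<inter> Sph"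
  let ?m = "measure M ?B"
  let ?i = "\<lambda>p. indicator ?B p / ?m :: real"
  have B: "?B \<in> sets M" by (rule ball_sets) simp
  have [measurable]: "indicator ?B \<in> borel_measurable M" using B by (rule borel_measurable_indicator)
  note [measurable] = h
  have i1: "(\<integral>p. ?i p \<partial>M) = 1" using B m by simp
  have ii: "integrable M ?i"
  proof (rule integrable_const_bound[of _ "1 / ?m"])
    show "AE p in M. norm (?i p) \<le> 1 / ?m" by (auto simp: indicator_def)
  qed measurable
  have bd: "\<bar>?i p * (h p - k)\<bar> \<le> ?i p * e" for p
    using e m by (auto simp: indicator_def abs_mult divide_right_mono)
  have ik: "integrable M (\<lambda>p. ?i p * (h p - k))"
    by (rule Bochner_Integration.integrable_bound[OF integrable_mult_left[OF ii, of e]])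
      (measurable, rule AE_I2, unfold real_norm_def, rule order_trans[OF bd abs_ge_self])
  have "(\<integral>p. indicator (ball a r) p / ?m * h p \<partial>M) = (\<integral>p. ?i p * (h p - k) + ?i p * k \<partial>M)"
    by (intro Bochner_Integration.integral_cong refl) (auto simp: indicator_def space_M diff_divide_distrib)
  also have "\<dots> = (\<integral>p. ?i p * (h p - k) \<partial>M) + (\<integral>p. ?i p * k \<partial>M)"
    using ii by (intro Bochner_Integration.integral_add ik integrable_mult_left)
  also have "(\<integral>p. ?i p * k \<partial>M) = k" using i1 by (simp only: Bochner_Integration.integral_mult_left_zero mult_1)
  finally have "\<bar>(\<integral>p. indicator (ball a r) p / ?m * h p \<partial>M) - k\<bar> = \<bar>\<integral>p. ?i p * (h p - k) \<partial>M\<bar>" by simp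
  also have "\<dots> \<le> (\<integral>p. \<bar>?i p * (h p - k)\<bar> \<partial>M)" by (rule integral_abs_bound)
  also have "\<dots> \<le> (\<integral>p. ?i p * e \<partial>M)"
    using ik bd ii by (intro integral_mono integrable_abs integrable_mult_left) auto
  also have "\<dots> = e" using i1 by (simp only: Bochner_Integration.integral_mult_left_zero mult_1)
  finally show ?thesis .
qed

text \<open>Tests \<open>second_order\<close> on combinations of normalised indicators of balls shrinking to the points
  \<open>a i\<close>, since \<open>M\<close> need not have atoms.\<close>

lemma G_conditionally_pos:
  fixes a :: "nat \<Rightarrow> 'a" and c :: "nat \<Rightarrow> real"
  assumes a: "\<And>i. i < n \<Longrightarrow> a i \<in> S" and c: "(\<Sum>i<n. c i) = 0"
  shows "0 \<le> (\<Sum>i<n. \<Sum>j<n. c i * c j * G (a i) (a j))"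
proof (rule field_le_epsilon)
  fix \<epsilon> :: real assume "\<epsilon> > 0"
  define C where "C = (\<Sum>i<n. \<Sum>j<n. \<bar>c i * c j\<bar>)"
  have C0: "C \<ge> 0" unfolding C_def by (intro sum_nonneg) auto
  define e where "e = \<epsilon> / (C + 1)"
  have e0: "e > 0" using C0 \<open>\<epsilon> > 0\<close> by (simp add: e_def)
  have aS: "a i \<in> Sph" if "i < n" for i using a[OF that] msupport_subset by blast
  have "uniformly_continuous_on (Sph \<times> Sph) (\<lambda>(x, y). G x y)"
    by (intro compact_uniformly_continuous continuous_on_G compact_Times compact_sphere)
  then obtain d where d: "d > 0" "\<And>p q. p \<in> Sph \<times> Sph \<Longrightarrow> q \<in> Sph \<times> Sph \<Longrightarrow> dist q p < d \<Longrightarrow>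
      dist ((\<lambda>(x, y). G x y) q) ((\<lambda>(x, y). G x y) p) < e"
    using e0 unfolding uniformly_continuous_on_def by metis
  define r where "r = d / 2"
  have close: "\<bar>G x y - G (a i) (a j)\<bar> \<le> e"
    if "x \<in> ball (a i) r \<inter> Sph" "y \<in> ball (a j) r \<inter> Sph" "i < n" "j < n" for x y i j
  proof -
    have "dist (x, y) (a i, a j) \<le> dist x (a i) + dist y (a j)"
      unfolding dist_prod_def by (simp add: sqrt_sum_squares_le_sum)
    also have "\<dots> < d" using that by (auto simp: r_def dist_commute)
    finally show ?thesis
      using d(2)[of "(a i, a j)" "(x, y)"] that aS by (auto simp: dist_real_def)
  qed
  define m where "m i = measure M (ball (a i) r \<inter> Sph)" for i
  have m: "m i > 0" if "i < n" for i
    using msupport_pos[OF a[OF that], of r] d(1) by (simp add: m_def r_def emeasure_eq_measure)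
  define u where "u i p = indicator (ball (a i) r) p / m i" for i and p :: 'a
  have um [measurable]: "u i \<in> borel_measurable M" for i
    unfolding u_def
    by (intro borel_measurable_divide measurable_compose[OF measurable_ident_M] borel_measurable_indicator)
      simp_all
  have u0: "u i p \<ge> 0" for i p by (simp add: u_def m_def)
  have ub: "u i p \<le> 1 / m i" for i p by (simp add: u_def m_def indicator_def)
  have ui: "integrable M (\<lambda>p. u i p * h p)" if h: "h \<in> borel_measurable M" "\<And>p. p \<in> Sph \<Longrightarrow> \<bar>h p\<bar> \<le> D" for i h D
  proof (rule integrable_const_bound[of _ "1 / m i * D"])
    show "AE p in M. norm (u i p * h p) \<le> 1 / m i * D"
    proof (rule AE_I2)
      fix p assume "p \<in> space M"
      then show "norm (u i p * h p) \<le> 1 / m i * D"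
        unfolding real_norm_def abs_mult using u0[of i p] ub[of i p] h(2)[of p]
        by (intro mult_mono) (auto simp: space_M m_def)
    qed
  qed (use h in measurable)
  define f where "f p = (\<Sum>i<n. c i * u i p)" for p
  have fm: "f \<in> borel_measurable M" unfolding f_def by measurable
  have fb: "\<bar>f p\<bar> \<le> (\<Sum>i<n. \<bar>c i\<bar> * (1 / m i))" for p
    unfolding f_def using u0 ub
    by (intro order_trans[OF sum_abs] sum_mono) (simp only: abs_mult abs_of_nonneg, intro mult_left_mono, auto)
  have fint: "(\<integral>p. f p * h p \<partial>M) = (\<Sum>i<n. c i * (\<integral>p. u i p * h p \<partial>M))"
    if h: "h \<in> borel_measurable M" "\<And>p. p \<in> Sph \<Longrightarrow> \<bar>h p\<bar> \<le> D" for h D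
  proof -
    have "(\<integral>p. f p * h p \<partial>M) = (\<integral>p. (\<Sum>i<n. c i * (u i p * h p)) \<partial>M)"
      by (simp add: f_def sum_distrib_right mult.assoc)
    also have "\<dots> = (\<Sum>i<n. \<integral>p. c i * (u i p * h p) \<partial>M)"
      using ui[OF h] by (intro Bochner_Integration.integral_sum) auto
    finally show ?thesis by simp
  qed
  have avg: "\<bar>(\<integral>p. u i p * h p \<partial>M) - k\<bar> \<le> e"
    if "h \<in> borel_measurable M" "\<And>p. p \<in> ball (a i) r \<inter> Sph \<Longrightarrow> \<bar>h p - k\<bar> \<le> e" "i < n" for h k i
    using integral_ball_close[OF that(1,2)] m[OF that(3)] e0 unfolding u_def m_def by simp
  define A where "A j x = (\<integral>y. u j y * G x y \<partial>M)" for j x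
  obtain Gb where Gb: "\<And>x y. x \<in> Sph \<Longrightarrow> y \<in> Sph \<Longrightarrow> \<bar>G x y\<bar> \<le> Gb"
  proof -
    obtain D where "\<And>q. q \<in> Sph \<times> Sph \<Longrightarrow> norm (case q of (x, y) \<Rightarrow> G x y) \<le> D"
      using continuous_on_bounded[OF compact_Times[OF compact_sphere compact_sphere] continuous_on_G] by blast
    from this[of "(x, y)" for x y] show thesis by (intro that[of D]) auto
  qed
  have Gm: "G x \<in> borel_measurable M" if "x \<in> Sph" for x
    by (rule continuous_on_measurable[OF continuous_on_G_section[OF that]])
  have Gpm: "(\<lambda>(x, y). G x y) \<in> borel_measurable (M \<Otimes>\<^sub>M M)"
    by (rule continuous_on_measurable_pair[OF continuous_on_G])
  have Am: "A j \<in> borel_measurable M" for j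
  proof -
    have "(\<lambda>(x, y). u j y * G x y) \<in> borel_measurable (M \<Otimes>\<^sub>M M)"
      unfolding split_beta using Gpm[unfolded split_beta]
      by (intro borel_measurable_times measurable_compose[OF measurable_snd um]) auto
    then show ?thesis unfolding A_def by (rule borel_measurable_lebesgue_integral)
  qed
  have Aclose: "\<bar>A j x - G (a i) (a j)\<bar> \<le> e" if "x \<in> ball (a i) r \<inter> Sph" "i < n" "j < n" for i j x
    unfolding A_def using that by (intro avg Gm close) auto
  have Ab: "\<exists>D. \<forall>x\<in>Sph. \<bar>A j x\<bar> \<le> D" if "j < n" for j
  proof (intro exI ballI)
    fix x assume x: "x \<in> Sph"
    have uij: "integrable M (\<lambda>y. u j y * Gb)" "integrable M (\<lambda>y. u j y * G x y)"
      using ui[of "\<lambda>_. Gb" "\<bar>Gb\<bar>"] ui[OF Gm[OF x], of Gb] Gb[OF x] by auto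
    have "\<bar>A j x\<bar> \<le> (\<integral>y. \<bar>u j y * G x y\<bar> \<partial>M)" unfolding A_def by (rule integral_abs_bound)
    also have "\<dots> \<le> (\<integral>y. u j y * Gb \<partial>M)"
      using uij Gb[OF x] u0 by (intro integral_mono integrable_abs) (auto simp: abs_mult space_M intro!: mult_left_mono)
    finally show "\<bar>A j x\<bar> \<le> (\<integral>y. u j y * Gb \<partial>M)" .
  qed
  define Q where "Q i j = (\<integral>x. u i x * A j x \<partial>M)" for i j
  have "0 \<le> (\<integral>x. f x * (\<integral>y. f y * G x y \<partial>M) \<partial>M)"
  proof (rule second_order[OF fm fb])
    have "(\<integral>p. u i p \<partial>M) = 1" if "i < n" for i
    proof -
      have "(\<integral>p. u i p \<partial>M) = (\<integral>p. indicator (ball (a i) r \<inter> Sph) p / m i \<partial>M)"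
        by (intro Bochner_Integration.integral_cong refl) (simp add: u_def indicator_def space_M)
      then show ?thesis using m[OF that] ball_sets[of "ball (a i) r"] by (simp add: m_def)
    qed
    then show "(\<integral>p. f p \<partial>M) = 0" using fint[of "\<lambda>_. 1" 1] c by simp
  qed
  also have "\<dots> = (\<integral>x. f x * (\<Sum>j<n. c j * A j x) \<partial>M)"
    unfolding A_def by (intro Bochner_Integration.integral_cong refl arg_cong2[of _ _ _ _ "(*)"] fint[of _ Gb])
      (auto simp: space_M intro!: Gm Gb)
  also have "\<dots> = (\<integral>x. (\<Sum>j<n. c j * (f x * A j x)) \<partial>M)"
    by (simp add: sum_distrib_left mult_ac)
  also have "\<dots> = (\<Sum>j<n. c j * (\<integral>x. f x * A j x \<partial>M))"
  proof (subst Bochner_Integration.integral_sum)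
    fix j assume "j \<in> {..<n}"
    then obtain D where D: "\<And>x. x \<in> Sph \<Longrightarrow> \<bar>A j x\<bar> \<le> D" using Ab[of j] unfolding lessThan_iff by blast
    have "integrable M (\<lambda>x. \<Sum>i<n. c i * (u i x * A j x))" using ui[OF Am D] by simp
    then show "integrable M (\<lambda>x. c j * (f x * A j x))"
      by (simp add: f_def sum_distrib_right mult.assoc)
  qed simp
  also have "\<dots> = (\<Sum>j<n. c j * (\<Sum>i<n. c i * Q i j))"
  proof (rule sum.cong[OF refl])
    fix j assume "j \<in> {..<n}"
    then obtain D where D: "\<And>x. x \<in> Sph \<Longrightarrow> \<bar>A j x\<bar> \<le> D" using Ab[of j] unfolding lessThan_iff by blast
    show "c j * (\<integral>x. f x * A j x \<partial>M) = c j * (\<Sum>i<n. c i * Q i j)"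
      unfolding Q_def by (subst fint[OF Am D]) auto
  qed
  also have "\<dots> = (\<Sum>i<n. \<Sum>j<n. c i * c j * Q i j)"
    by (subst sum.swap) (simp add: sum_distrib_left mult_ac)
  also have "\<dots> \<le> (\<Sum>i<n. \<Sum>j<n. c i * c j * G (a i) (a j) + \<bar>c i * c j\<bar> * e)"
  proof (intro sum_mono)
    fix i j assume ij: "i \<in> {..<n}" "j \<in> {..<n}"
    have "\<bar>Q i j - G (a i) (a j)\<bar> \<le> e"
      unfolding Q_def using ij by (intro avg Am Aclose) auto
    then have "\<bar>c i * c j * (Q i j - G (a i) (a j))\<bar> \<le> \<bar>c i * c j\<bar> * e"
      by (simp add: abs_mult mult_left_mono)
    then show "c i * c j * Q i j \<le> c i * c j * G (a i) (a j) + \<bar>c i * c j\<bar> * e"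
      by (simp add: algebra_simps abs_le_iff)
  qed
  also have "\<dots> = (\<Sum>i<n. \<Sum>j<n. c i * c j * G (a i) (a j)) + C * e"
    by (simp add: C_def sum.distrib sum_distrib_right)
  also have "C * e \<le> \<epsilon>"
    using C0 \<open>\<epsilon> > 0\<close> by (simp add: e_def field_simps)
  finally show "0 \<le> (\<Sum>i<n. \<Sum>j<n. c i * c j * G (a i) (a j)) + \<epsilon>" by simp
qed

lemma H_nonneg: "H x y \<ge> 0"
  unfolding H_def by simp

lemma H_le_1: assumes "x \<in> Sph" "y \<in> Sph" shows "H x y \<le> 1"
  unfolding H_def
proof (rule integral_le_const)
  show "integrable M (\<lambda>z. \<bar>x \<bullet> z\<bar> * \<bar>y \<bullet> z\<bar>)"
    by (intro continuous_on_integrable continuous_intros)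
  show "AE z in M. \<bar>x \<bullet> z\<bar> * \<bar>y \<bullet> z\<bar> \<le> 1"
    using assms by (intro AE_I2 mult_le_one) (auto simp: space_M abs_inner_le_1)
qed

lemma G_diag_diff:
  assumes x: "x \<in> Sph" "x' \<in> Sph"
  shows "G x x - 2 * G x x' + G x' x' \<le> 2 * (norm (x - x'))\<^sup>2"
proof -
  have nx: "x \<bullet> x = 1" "x' \<bullet> x' = 1" using x by (auto simp: norm_eq_1)
  have n2: "(norm (x - x'))\<^sup>2 = 2 - 2 * (x \<bullet> x')"
    using nx by (simp add: power2_norm_eq_inner inner_diff_left inner_diff_right inner_commute)
  have i: "integrable M (\<lambda>z. \<bar>p \<bullet> z\<bar> * \<bar>q \<bullet> z\<bar>)" for p q
    by (intro continuous_on_integrable continuous_intros)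
  have "H x x + H x' x' - 2 * H x x' = (\<integral>z. (\<bar>x \<bullet> z\<bar> - \<bar>x' \<bullet> z\<bar>)\<^sup>2 \<partial>M)"
  proof -
    have "(\<integral>z. (\<bar>x \<bullet> z\<bar> - \<bar>x' \<bullet> z\<bar>)\<^sup>2 \<partial>M) =
      (\<integral>z. \<bar>x \<bullet> z\<bar> * \<bar>x \<bullet> z\<bar> + \<bar>x' \<bullet> z\<bar> * \<bar>x' \<bullet> z\<bar> - 2 * (\<bar>x \<bullet> z\<bar> * \<bar>x' \<bullet> z\<bar>) \<partial>M)"
      by (intro Bochner_Integration.integral_cong refl) (simp add: power2_eq_square algebra_simps)
    also have "\<dots> = H x x + H x' x' - 2 * H x x'"
      unfolding H_def using i[of x x] i[of x' x'] i[of x x'] by simp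
    finally show ?thesis by simp
  qed
  also have "\<dots> \<le> (norm (x - x'))\<^sup>2"
  proof (rule integral_le_const)
    show "AE z in M. (\<bar>x \<bullet> z\<bar> - \<bar>x' \<bullet> z\<bar>)\<^sup>2 \<le> (norm (x - x'))\<^sup>2"
    proof (rule AE_I2)
      fix z assume z: "z \<in> space M"
      have "\<bar>\<bar>x \<bullet> z\<bar> - \<bar>x' \<bullet> z\<bar>\<bar> \<le> \<bar>(x - x') \<bullet> z\<bar>" by (simp add: inner_diff_left)
      also have "\<dots> \<le> norm (x - x')" using Cauchy_Schwarz_ineq2[of "x - x'" z] z by (simp add: space_M)
      finally show "(\<bar>x \<bullet> z\<bar> - \<bar>x' \<bullet> z\<bar>)\<^sup>2 \<le> (norm (x - x'))\<^sup>2"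
        by (intro abs_le_square_iff[THEN iffD1]) simp
    qed
  qed (intro continuous_on_integrable continuous_intros)
  finally have 1: "H x x + H x' x' - 2 * H x x' \<le> (norm (x - x'))\<^sup>2" .
  have "2 * (1 - \<bar>x \<bullet> x'\<bar>) * H x x' \<le> (norm (x - x'))\<^sup>2 * 1"
    using H_le_1[OF x] H_nonneg[of x x'] n2 abs_inner_le_1[of x x'] x by (intro mult_mono) auto
  then show ?thesis using 1 nx by (simp add: G_def algebra_simps)
qed

lemma H_commute: "H x y = H y x" by (simp add: H_def mult.commute)
lemma G_commute: "G x y = G y x" by (simp add: G_def H_commute inner_commute)

text \<open>The test charge puts mass \<open>|y - y'|\<close> at \<open>x\<close>, its negative at \<open>x'\<close>, mass \<open>|x - x'|\<close> at \<open>y\<close> and its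
  negative at \<open>y'\<close>: at orthogonal pairs the kink of \<open>G\<close> makes the cross terms of first order,
  while the diagonal terms are of second order.\<close>

lemma G_orthogonal_pairs:
  assumes S: "x \<in> S" "x' \<in> S" "y \<in> S" "y' \<in> S" and o: "x \<bullet> y = 0" "x' \<bullet> y' = 0"
  shows "G x y' + G x' y \<le> 2 * norm (x - x') * norm (y - y')"
proof (cases "x = x' \<or> y = y'")
  case True
  then show ?thesis using o by (auto simp: G_def)
next
  case False
  define p where "p = norm (x - x')"
  define q where "q = norm (y - y')"
  have pq: "p > 0" "q > 0" using False by (auto simp: p_def q_def)
  define a where "a = (\<lambda>i::nat. if i = 0 then x else if i = 1 then x' else if i = 2 then y else y')"
  define c where "c = (\<lambda>i::nat. if i = 0 then q else if i = 1 then -q else if i = 2 then p else -p)"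
  have aS: "a i \<in> S" for i using S by (auto simp: a_def)
  have e4: "{..<4::nat} = {0, 1, 2, 3}" by auto
  have cs: "(\<Sum>i<4. c i) = 0" unfolding e4 by (simp add: c_def)
  have o0: "G x y = 0" "G x' y' = 0" using o by (auto simp: G_def)
  have "0 \<le> (\<Sum>i<4. \<Sum>j<4. c i * c j * G (a i) (a j))"
    by (rule G_conditionally_pos[OF aS cs])
  also have "\<dots> = q\<^sup>2 * (G x x - 2 * G x x' + G x' x') + p\<^sup>2 * (G y y - 2 * G y y' + G y' y')
      - 2 * p * q * (G x y' + G x' y)"
    unfolding e4 using o0 G_commute[of x' x] G_commute[of y' y] G_commute[of y x] G_commute[of y x']
      G_commute[of y' x] G_commute[of y' x']
    by (simp add: c_def a_def algebra_simps power2_eq_square)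
  also have "\<dots> \<le> q\<^sup>2 * (2 * p\<^sup>2) + p\<^sup>2 * (2 * q\<^sup>2) - 2 * p * q * (G x y' + G x' y)"
    using S[THEN subsetD[OF msupport_subset]] unfolding p_def q_def
    by (intro diff_right_mono add_mono mult_left_mono G_diag_diff) auto
  finally have "2 * p * q * (G x y' + G x' y) \<le> 2 * p * q * (2 * p * q)"
    by (simp add: algebra_simps power2_eq_square)
  then show ?thesis using pq by (simp add: p_def q_def)
qed

end

subsection \<open>Points of the support with no orthogonal partner\<close>

lemma bilinear_nonneg_zero:
  fixes b :: "'a::euclidean_space \<Rightarrow> 'a \<Rightarrow> real"
  assumes b: "bilinear b" and \<delta>: "\<delta> > 0" and nn: "\<And>v. norm (v - x) < \<delta> \<Longrightarrow> 0 \<le> b v v" and 0: "b x x = 0"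
  shows "b x v + b v x = 0" and "b v v \<ge> 0"
proof -
  have expand: "0 \<le> 3 * t * ((b x v + b v x) / 3) + 3 * t\<^sup>2 * (b v v / 3) + t ^ 3 * 0"
    if t: "0 < t" "t < \<delta> / (norm v + 1)" for t v
  proof -
    have "t * norm v \<le> t * (norm v + 1)" using t by simp
    also have "\<dots> < \<delta>"
      using t(2) pos_less_divide_eq[of "norm v + 1" t \<delta>] by (simp add: add_nonneg_pos)
    finally have "0 \<le> b (x + t *\<^sub>R v) (x + t *\<^sub>R v)" using t by (intro nn) simp
    also have "\<dots> = t * (b x v + b v x) + t\<^sup>2 * b v v"
      using b 0 by (simp add: bilinear_ladd bilinear_radd bilinear_lmul bilinear_rmul algebra_simps power2_eq_square)
    finally show ?thesis by simp
  qed
  have t0: "\<delta> / (norm v + 1) > 0" for v :: 'a using \<delta> by (simp add: add_nonneg_pos)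
  have ge: "b x v + b v x \<ge> 0" for v
    using cubic_nonneg_coeffs(1)[OF t0 expand] by simp
  have "b x v + b v x \<le> 0"
    using ge[of "- v"] b by (simp add: bilinear_lneg bilinear_rneg)
  then show eq: "b x v + b v x = 0" using ge[of v] by simp
  then show "b v v \<ge> 0" using cubic_nonneg_coeffs(2)[OF t0 expand] by simp
qed

context frame3_minimizer
begin

lemma F_ge_norm: "I * (v \<bullet> v) \<le> F v"
proof (cases "v = 0")
  case False
  let ?u = "v /\<^sub>R norm v"
  have v: "v = norm v *\<^sub>R ?u" using False by simp
  have "frame3_kernel v y z = (norm v)\<^sup>2 * frame3_kernel ?u y z" for y z
    by (subst (1 2) v) (simp only: inner_scaleR_left abs_mult abs_norm_cancel, simp add: power2_eq_square)
  then have "F v = (norm v)\<^sup>2 * F ?u" by (simp add: F_def)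
  moreover have "I \<le> F ?u" using False by (intro F_ge) simp
  ultimately show ?thesis
    by (simp add: power2_norm_eq_inner[symmetric] mult.commute[of I] mult_left_mono)
qed (simp add: F_def)

end

locale frame3_nonorthogonal = frame3_minimizer +
  fixes x\<^sub>0 \<delta>
  assumes x0: "x\<^sub>0 \<in> msupport M" and \<delta>: "\<delta> > 0" and x0_inner: "y \<in> msupport M \<Longrightarrow> \<delta> \<le> \<bar>x\<^sub>0 \<bullet> y\<bar>"
begin

text \<open>A continuous extension of the sign of \<open>x\<^sub>0 \<bullet> y\<close> from the support to the whole space.\<close>

definition \<sigma> :: "'a \<Rightarrow> real" where "\<sigma> y = max (-1) (min 1 ((x\<^sub>0 \<bullet> y) / \<delta>))"

definition L :: "'a \<Rightarrow> 'a \<Rightarrow> real" where "L w y = (\<integral>z. \<sigma> z * (w \<bullet> z) * \<bar>y \<bullet> z\<bar> \<partial>M)"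

definition B :: "'a \<Rightarrow> 'a \<Rightarrow> real" where "B v w = (\<integral>y. \<sigma> y * (v \<bullet> y) * L w y \<partial>M)"

lemma continuous_on_\<sigma> [continuous_intros]: "continuous_on A f \<Longrightarrow> continuous_on A (\<lambda>y. \<sigma> (f y))"
  unfolding \<sigma>_def using \<delta> by (intro continuous_intros) auto

lemma \<sigma>_cases: "y \<in> S \<Longrightarrow> \<sigma> y = (if x\<^sub>0 \<bullet> y > 0 then 1 else -1)"
  using x0_inner[of y] \<delta> by (auto simp: \<sigma>_def field_simps max_def min_def)

lemma \<sigma>_square: "y \<in> S \<Longrightarrow> \<sigma> y * \<sigma> y = 1"
  by (simp add: \<sigma>_cases)

lemma \<sigma>_mult: "y \<in> S \<Longrightarrow> norm (v - x\<^sub>0) < \<delta> \<Longrightarrow> \<sigma> y * (v \<bullet> y) = \<bar>v \<bullet> y\<bar>"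
proof -
  assume y: "y \<in> S" and v: "norm (v - x\<^sub>0) < \<delta>"
  have "\<bar>(v - x\<^sub>0) \<bullet> y\<bar> < \<delta>"
    using Cauchy_Schwarz_ineq2[of "v - x\<^sub>0" y] y v msupport_subset by auto
  then show ?thesis using x0_inner[OF y] y by (auto simp: \<sigma>_cases inner_diff_left)
qed

lemma x0_Sph: "x\<^sub>0 \<in> Sph" using x0 msupport_subset by blast

lemma \<sigma>_x0: "\<sigma> x\<^sub>0 = 1"
  using \<sigma>_cases[OF x0] x0_Sph by auto

lemma L_integrand_continuous: "continuous_on A (\<lambda>z. \<sigma> z * (w \<bullet> z) * \<bar>y \<bullet> z\<bar>)"
  by (intro continuous_intros)

lemma continuous_on_L [continuous_intros]: "continuous_on Sph (L w)"
  unfolding L_def[abs_def]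
  by (rule continuous_on_integral[OF compact_sphere]) (unfold split_beta, intro continuous_intros)

lemma bilinear_B: "bilinear B"
proof -
  have L_add: "L (w + w') y = L w y + L w' y" for w w' y
    unfolding L_def using continuous_on_integrable[OF L_integrand_continuous]
    by (simp add: inner_add_left algebra_simps flip: Bochner_Integration.integral_add)
  have L_scale: "L (r *\<^sub>R w) y = r * L w y" for r w y
    unfolding L_def by (simp add: mult_ac flip: Bochner_Integration.integral_mult_right_zero)
  have i: "integrable M (\<lambda>y. \<sigma> y * (v \<bullet> y) * L w y)" for v w
    by (intro continuous_on_integrable continuous_intros)
  show ?thesis unfolding bilinear_def
  proof (intro conjI allI linearI)
    fix v w w'
    have "B v (w + w') = (\<integral>y. \<sigma> y * (v \<bullet> y) * L w y + \<sigma> y * (v \<bullet> y) * L w' y \<partial>M)"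
      unfolding B_def by (simp add: L_add distrib_left)
    then show "B v (w + w') = B v w + B v w'" using i by (simp add: B_def)
    have "B (w + w') v = (\<integral>y. \<sigma> y * (w \<bullet> y) * L v y + \<sigma> y * (w' \<bullet> y) * L v y \<partial>M)"
      unfolding B_def by (simp add: inner_add_left algebra_simps)
    then show "B (w + w') v = B w v + B w' v" using i by (simp add: B_def)
  next
    fix r v w
    have "B v (r *\<^sub>R w) = (\<integral>y. r * (\<sigma> y * (v \<bullet> y) * L w y) \<partial>M)"
      unfolding B_def by (simp add: L_scale mult_ac)
    then show "B v (r *\<^sub>R w) = r *\<^sub>R B v w" by (simp add: B_def)
    have "B (r *\<^sub>R w) v = (\<integral>y. r * (\<sigma> y * (w \<bullet> y) * L v y) \<partial>M)"
      unfolding B_def by (simp add: mult_ac)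
    then show "B (r *\<^sub>R w) v = r *\<^sub>R B w v" by (simp add: B_def)
  qed
qed

lemma F_eq_B: "norm (v - x\<^sub>0) < \<delta> \<Longrightarrow> F v = B v v"
proof -
  assume v: "norm (v - x\<^sub>0) < \<delta>"
  have HL: "H v y = L v y" for y
    unfolding H_def L_def
    by (intro integral_cong_msupport continuous_on_measurable continuous_intros) (simp add: \<sigma>_mult[OF _ v])
  have "F v = (\<integral>y. \<bar>v \<bullet> y\<bar> * L v y \<partial>M)" by (simp add: F_eq G_def HL)
  also have "\<dots> = B v v"
    unfolding B_def
    by (intro integral_cong_msupport continuous_on_measurable continuous_intros) (simp add: \<sigma>_mult[OF _ v])
  finally show ?thesis .
qed

definition q :: "'a \<Rightarrow> 'a \<Rightarrow> real" where "q v w = B v w - I * (v \<bullet> w)"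

lemma bilinear_q: "bilinear q"
proof -
  have "linear (\<lambda>w. I * (v \<bullet> w))" "linear (\<lambda>w. I * (w \<bullet> v))" for v :: 'a
    by (auto intro!: linearI simp: inner_add_left inner_add_right algebra_simps)
  then show ?thesis
    using bilinear_B unfolding bilinear_def q_def by (auto intro!: linear_compose_sub)
qed

lemma q_kernel:
  assumes "x \<in> S \<inter> ball x\<^sub>0 \<delta>" shows "q x w + q w x = 0"
proof -
  have nn: "0 \<le> q v v" if "norm (v - x\<^sub>0) < \<delta>" for v
    using F_ge_norm[of v] F_eq_B[OF that] by (simp add: q_def)
  have z: "q x x = 0" if "x \<in> S \<inter> ball x\<^sub>0 \<delta>" for x
  proof -
    have "norm (x - x\<^sub>0) < \<delta>" using that by (simp add: dist_norm norm_minus_commute)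
    moreover have "x \<bullet> x = 1" using that msupport_subset by (auto simp flip: norm_eq_1)
    ultimately show ?thesis using F_eq_I[of x] F_eq_B[of x] that by (simp add: q_def)
  qed
  have x0z: "q x\<^sub>0 x\<^sub>0 = 0" using z[of x\<^sub>0] x0 \<delta> by simp
  have q0: "q v v \<ge> 0" for v by (rule bilinear_nonneg_zero(2)[OF bilinear_q \<delta> nn x0z])
  show ?thesis
    by (rule bilinear_nonneg_zero(1)[OF bilinear_q \<delta> q0 z[OF assms]])
qed

lemma hyperplane_if_q_nonzero:
  assumes "q w w \<noteq> 0"
  obtains u where "u \<noteq> 0" "S \<inter> ball x\<^sub>0 \<delta> \<subseteq> {x \<in> Sph. u \<bullet> x = 0}"
proof -
  let ?f = "\<lambda>x. q x w + q w x"
  have lin: "linear ?f"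
    using bilinear_q unfolding bilinear_def by (intro linear_compose_add) auto
  have u: "adjoint ?f 1 \<bullet> x = ?f x" for x
    using adjoint_works[OF lin, of x 1] by (simp add: inner_commute)
  have "adjoint ?f 1 \<noteq> 0"
    using u[of w] assms by auto
  then show thesis
    by (rule that) (use u q_kernel msupport_subset in auto)
qed

definition A :: "'a \<Rightarrow> 'a" where "A v = (\<integral>z. (v \<bullet> z) *\<^sub>R z \<partial>M)"

lemma A_inner: "A v \<bullet> w = (\<integral>z. (v \<bullet> z) * (w \<bullet> z) \<partial>M)"
proof -
  have "integrable M (\<lambda>z. (v \<bullet> z) *\<^sub>R z)" by (intro continuous_on_integrable continuous_intros)
  from integral_inner_left[OF this, of w]
  have "A v \<bullet> w = (\<integral>z. ((v \<bullet> z) *\<^sub>R z) \<bullet> w \<partial>M)" by (simp add: A_def)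
  then show ?thesis by (simp add: inner_commute)
qed

lemma A_diff: "A (v - w) = A v - A w"
  by (rule vector_eq_rdot[THEN iffD1, THEN sym, THEN sym])
    (auto simp: A_inner inner_diff_left left_diff_distrib intro!: Bochner_Integration.integral_diff
      continuous_on_integrable continuous_intros)

lemma A_add: "A (v + w) = A v + A w"
  using A_diff[of "v + w" w] by simp

lemma A_scale: "A (r *\<^sub>R v) = r *\<^sub>R A v"
  by (rule vector_eq_rdot[THEN iffD1]) (simp add: A_inner mult_ac)

text \<open>If \<open>q\<close> vanished, the support folded by \<open>\<sigma>\<close> would have nonnegative inner products and frame
  operator \<open>A = c\<close>. Then \<open>p v = \<sigma> v (v \<bullet> m)\<close>, with \<open>m\<close> the barycentre of the folded measure, satisfies
  \<open>p \<ge> c\<close> and \<open>\<integral> p (p - c) = 0\<close>, which leaves only \<open>|x\<^sub>0 \<bullet> y| = 1\<close> on the support.\<close>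

lemma q_not_zero:
  assumes dim: "DIM('a) \<ge> 2"
  shows "\<exists>w. q w w \<noteq> 0"
proof (rule ccontr)
  assume "\<not> ?thesis"
  then have BI: "B v v = I * (v \<bullet> v)" for v by (simp add: q_def)
  have folded: "\<bar>v \<bullet> y\<bar> = \<sigma> v * \<sigma> y * (v \<bullet> y)" if v: "v \<in> S" and y: "y \<in> S" for v y
  proof -
    let ?g = "\<lambda>y z. \<bar>v \<bullet> y\<bar> * (\<bar>v \<bullet> z\<bar> * \<bar>y \<bullet> z\<bar>) - \<sigma> y * (v \<bullet> y) * (\<sigma> z * (v \<bullet> z) * \<bar>y \<bullet> z\<bar>)"
    have gc: "continuous_on Sph (?g y)" for y by (intro continuous_intros)
    have g0: "?g y z \<ge> 0" for y z
    proof -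
      have s: "\<bar>\<sigma> y\<bar> \<le> 1" for y by (auto simp: \<sigma>_def)
      have "\<sigma> y * (v \<bullet> y) * (\<sigma> z * (v \<bullet> z) * \<bar>y \<bullet> z\<bar>) \<le>
          \<bar>\<sigma> y * \<sigma> z\<bar> * (\<bar>v \<bullet> y\<bar> * (\<bar>v \<bullet> z\<bar> * \<bar>y \<bullet> z\<bar>))"
        using abs_ge_self[of "\<sigma> y * (v \<bullet> y) * (\<sigma> z * (v \<bullet> z) * \<bar>y \<bullet> z\<bar>)"] by (simp add: abs_mult mult_ac)
      also have "\<dots> \<le> 1 * (\<bar>v \<bullet> y\<bar> * (\<bar>v \<bullet> z\<bar> * \<bar>y \<bullet> z\<bar>))"
        using s by (intro mult_right_mono) (auto simp: abs_mult mult_le_one)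
      finally show ?thesis by simp
    qed
    have gi: "(\<integral>z. ?g y z \<partial>M) = G v y - \<sigma> y * (v \<bullet> y) * L v y" for y
    proof -
      have "integrable M (\<lambda>z. \<bar>v \<bullet> z\<bar> * \<bar>y \<bullet> z\<bar>)" "integrable M (\<lambda>z. \<sigma> z * (v \<bullet> z) * \<bar>y \<bullet> z\<bar>)"
        by (intro continuous_on_integrable continuous_intros)+
      then show ?thesis by (simp add: G_def H_def L_def)
    qed
    have vS: "v \<in> Sph" using v msupport_subset by blast
    have "(\<integral>z. ?g y z \<partial>M) = 0"
    proof (rule zero_on_msupport[OF _ _ _ y])
      have c: "continuous_on Sph (\<lambda>y. \<sigma> y * (v \<bullet> y) * L v y)" by (intro continuous_intros)
      show "continuous_on Sph (\<lambda>y. \<integral>z. ?g y z \<partial>M)"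
        unfolding gi by (intro continuous_on_diff c continuous_on_G_section[OF vS])
      from c continuous_on_G_section[OF vS] have "(\<integral>y. \<integral>z. ?g y z \<partial>M \<partial>M) = F v - B v v"
        unfolding gi F_eq B_def by (intro Bochner_Integration.integral_diff continuous_on_integrable)
      also have "\<dots> = 0" using F_eq_I[OF v] BI[of v] vS by (simp add: norm_eq_1)
      finally show "(\<integral>y. \<integral>z. ?g y z \<partial>M \<partial>M) = 0" .
    qed (rule Bochner_Integration.integral_nonneg, rule g0)
    then have "?g y x\<^sub>0 = 0" by (rule zero_on_msupport[OF gc g0 _ x0])
    then have g: "\<bar>v \<bullet> y\<bar> * (\<bar>v \<bullet> x\<^sub>0\<bar> * \<bar>y \<bullet> x\<^sub>0\<bar>) - \<sigma> y * (v \<bullet> y) * (1 * (v \<bullet> x\<^sub>0) * \<bar>y \<bullet> x\<^sub>0\<bar>) = 0"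
      by (simp only: \<sigma>_x0)
    have "\<sigma> v * (x\<^sub>0 \<bullet> v) = \<bar>x\<^sub>0 \<bullet> v\<bar>" using \<sigma>_mult[OF v, of x\<^sub>0] \<delta> by simp
    then have r: "v \<bullet> x\<^sub>0 = \<sigma> v * \<bar>v \<bullet> x\<^sub>0\<bar>"
      using \<sigma>_square[OF v] by (metis inner_commute mult.assoc mult_1)
    have pos: "\<bar>v \<bullet> x\<^sub>0\<bar> > 0" "\<bar>y \<bullet> x\<^sub>0\<bar> > 0"
      using x0_inner[OF v] x0_inner[OF y] \<delta> by (auto simp: inner_commute)
    have "(a - s * t * w) * (b * c) = 0" if "a * (b * c) - t * w * (1 * r * c) = 0" "r = s * b"
      for a b c r s t w :: real
      using that by (simp add: algebra_simps)
    from this[OF g r] show ?thesis using pos by simp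
  qed
  have L_A: "L v y = \<sigma> y * (A v \<bullet> y)" if y: "y \<in> S" for v y
  proof -
    have "L v y = (\<integral>z. \<sigma> y * ((v \<bullet> z) * (y \<bullet> z)) \<partial>M)"
      unfolding L_def
    proof (intro integral_cong_msupport continuous_on_measurable continuous_intros)
      fix z assume z: "z \<in> S"
      show "\<sigma> z * (v \<bullet> z) * \<bar>y \<bullet> z\<bar> = \<sigma> y * ((v \<bullet> z) * (y \<bullet> z))"
        unfolding folded[OF y z] using \<sigma>_square[OF z] by (simp add: algebra_simps)
    qed
    then show ?thesis by (simp add: A_inner)
  qed
  have AA: "A v \<bullet> A v = I * (v \<bullet> v)" for v
  proof -
    have "B v v = (\<integral>y. (v \<bullet> y) * (A v \<bullet> y) \<partial>M)"
      unfolding B_def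
    proof (intro integral_cong_msupport continuous_on_measurable continuous_intros)
      fix y assume y: "y \<in> S"
      show "\<sigma> y * (v \<bullet> y) * L v y = (v \<bullet> y) * (A v \<bullet> y)"
        unfolding L_A[OF y] using \<sigma>_square[OF y] by (simp add: algebra_simps)
    qed
    then show ?thesis using BI[of v] A_inner[of v "A v"] by simp
  qed
  have polar: "A v \<bullet> A w = I * (v \<bullet> w)" for v w
    using AA[of "v + w"] AA[of v] AA[of w]
    by (simp add: A_add inner_add_left inner_add_right inner_commute algebra_simps)
  have A_sym: "A v \<bullet> w = v \<bullet> A w" for v w
    using A_inner[of v w] A_inner[of w v] by (simp add: inner_commute mult.commute)
  have I_pos: "I > 0"
  proof -
    have "\<delta>\<^sup>2 \<le> A x\<^sub>0 \<bullet> x\<^sub>0"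
      unfolding A_inner
    proof (rule integral_ge_const)
      show "AE y in M. \<delta>\<^sup>2 \<le> (x\<^sub>0 \<bullet> y) * (x\<^sub>0 \<bullet> y)"
        using AE_msupport
      proof eventually_elim
        case (elim y)
        show ?case using power_mono[OF x0_inner[OF elim], of 2] \<delta> by (simp add: power2_eq_square)
      qed
    qed (intro continuous_on_integrable continuous_intros)
    then have "A x\<^sub>0 \<noteq> 0" using \<delta> by auto
    then show ?thesis using AA[of x\<^sub>0] x0_Sph by (simp add: norm_eq_1 flip: inner_gt_zero_iff)
  qed
  define c where "c = sqrt I"
  have c: "c > 0" "c * c = I" using I_pos by (auto simp: c_def)
  have A_c: "A v = c *\<^sub>R v" for v
  proof -
    define u where "u = A v - c *\<^sub>R v"
    have Au: "A u = A (A v) - c *\<^sub>R A v" by (simp add: u_def A_diff A_scale)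
    have "A u \<bullet> u \<ge> 0" unfolding A_inner by simp
    moreover have "A u \<bullet> u + c * (u \<bullet> u) = 0"
    proof -
      have "A u \<bullet> u + c * (u \<bullet> u) = u \<bullet> (A u + c *\<^sub>R u)"
        by (simp add: inner_add_right inner_commute)
      also have "A u + c *\<^sub>R u = A (A v) - I *\<^sub>R v"
        by (simp add: Au) (simp add: u_def scaleR_diff_right c(2))
      also have "u \<bullet> \<dots> = A u \<bullet> A v - I * (u \<bullet> v)" by (simp add: inner_diff_right A_sym)
      finally show ?thesis using polar by simp
    qed
    ultimately have "c * (u \<bullet> u) \<le> 0" by linarith
    then have "u \<bullet> u \<le> 0" using c(1) by (simp add: mult_le_0_iff)
    then have "u = 0" using inner_gt_zero_iff[of u] by linarith
    then show ?thesis by (simp add: u_def)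
  qed
  have sq: "(\<integral>y. (v \<bullet> y) * (v \<bullet> y) \<partial>M) = c * (v \<bullet> v)" for v
    using A_inner[of v v] by (simp add: A_c)
  define m where "m = (\<integral>y. \<sigma> y *\<^sub>R y \<partial>M)"
  have m_inner: "v \<bullet> m = (\<integral>y. \<sigma> y * (v \<bullet> y) \<partial>M)" for v
  proof -
    have "integrable M (\<lambda>y. \<sigma> y *\<^sub>R y)" by (intro continuous_on_integrable continuous_intros)
    from integral_inner_right[OF this, of v] show ?thesis by (simp add: m_def)
  qed
  have p_eq: "\<sigma> v * (v \<bullet> m) = (\<integral>y. \<bar>v \<bullet> y\<bar> \<partial>M)" if v: "v \<in> S" for v
  proof -
    have "\<sigma> v * (v \<bullet> m) = (\<integral>y. \<sigma> v * \<sigma> y * (v \<bullet> y) \<partial>M)" by (simp add: m_inner mult.assoc)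
    also have "\<dots> = (\<integral>y. \<bar>v \<bullet> y\<bar> \<partial>M)"
      by (intro integral_cong_msupport continuous_on_measurable continuous_intros) (simp add: folded[OF v])
    finally show ?thesis .
  qed
  have sq_le: "(v \<bullet> y) * (v \<bullet> y) \<le> \<bar>v \<bullet> y\<bar>" if "v \<in> S" "y \<in> Sph" for v y
  proof -
    have "\<bar>v \<bullet> y\<bar> * \<bar>v \<bullet> y\<bar> \<le> \<bar>v \<bullet> y\<bar> * 1"
      using that msupport_subset by (intro mult_left_mono abs_inner_le_1) auto
    then show ?thesis by (simp add: abs_mult_self_eq)
  qed
  have p_ge: "\<sigma> v * (v \<bullet> m) \<ge> c" if v: "v \<in> S" for v
  proof -
    have "c = (\<integral>y. (v \<bullet> y) * (v \<bullet> y) \<partial>M)" using v msupport_subset by (auto simp: sq norm_eq_1)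
    also have "\<dots> \<le> (\<integral>y. \<bar>v \<bullet> y\<bar> \<partial>M)"
      by (intro integral_mono continuous_on_integrable continuous_intros) (use sq_le[OF v] in \<open>auto simp: space_M\<close>)
    finally show ?thesis using p_eq[OF v] by simp
  qed
  have "(x\<^sub>0 \<bullet> m) * (x\<^sub>0 \<bullet> m) - c * (\<sigma> x\<^sub>0 * (x\<^sub>0 \<bullet> m)) = 0"
  proof (rule zero_on_msupport[OF _ _ _ x0, where g = "\<lambda>v. (v \<bullet> m) * (v \<bullet> m) - c * (\<sigma> v * (v \<bullet> m))"])
    show "continuous_on Sph (\<lambda>v. (v \<bullet> m) * (v \<bullet> m) - c * (\<sigma> v * (v \<bullet> m)))"
      by (intro continuous_intros)
    fix v assume v: "v \<in> S"
    have "(v \<bullet> m) * (v \<bullet> m) - c * (\<sigma> v * (v \<bullet> m)) = (\<sigma> v * (v \<bullet> m)) * (\<sigma> v * (v \<bullet> m) - c)"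
      using \<sigma>_square[OF v] by (simp add: algebra_simps)
    then show "0 \<le> (v \<bullet> m) * (v \<bullet> m) - c * (\<sigma> v * (v \<bullet> m))"
      using p_ge[OF v] c(1) by simp
  next
    have i: "integrable M (\<lambda>v. (v \<bullet> m) * (v \<bullet> m))" "integrable M (\<lambda>v. \<sigma> v * (v \<bullet> m))"
      by (intro continuous_on_integrable continuous_intros)+
    have "(\<integral>v. (v \<bullet> m) * (v \<bullet> m) \<partial>M) = c * (m \<bullet> m)" using sq[of m] by (simp add: inner_commute)
    moreover have "(\<integral>v. \<sigma> v * (v \<bullet> m) \<partial>M) = m \<bullet> m" using m_inner[of m] by (simp add: inner_commute)
    ultimately show "(\<integral>v. (v \<bullet> m) * (v \<bullet> m) - c * (\<sigma> v * (v \<bullet> m)) \<partial>M) = 0" using i by simp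
  qed
  moreover note \<sigma>_x0
  ultimately have "(x\<^sub>0 \<bullet> m) * (x\<^sub>0 \<bullet> m - c) = 0" by (simp add: algebra_simps)
  then have "x\<^sub>0 \<bullet> m = c" using p_ge[OF x0] c(1) \<sigma>_x0 by auto
  then have i0: "(\<integral>y. \<bar>x\<^sub>0 \<bullet> y\<bar> \<partial>M) = c" using p_eq[OF x0] \<sigma>_x0 by simp
  have one: "(x\<^sub>0 \<bullet> y) * (x\<^sub>0 \<bullet> y) = 1" if y: "y \<in> S" for y
  proof -
    have "\<bar>x\<^sub>0 \<bullet> y\<bar> - (x\<^sub>0 \<bullet> y) * (x\<^sub>0 \<bullet> y) = 0"
    proof (rule zero_on_msupport[OF _ _ _ y])
      show "continuous_on Sph (\<lambda>y. \<bar>x\<^sub>0 \<bullet> y\<bar> - (x\<^sub>0 \<bullet> y) * (x\<^sub>0 \<bullet> y))" by (intro continuous_intros)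
      have "integrable M (\<lambda>y. \<bar>x\<^sub>0 \<bullet> y\<bar>)" "integrable M (\<lambda>y. (x\<^sub>0 \<bullet> y) * (x\<^sub>0 \<bullet> y))"
        by (intro continuous_on_integrable continuous_intros)+
      then show "(\<integral>y. \<bar>x\<^sub>0 \<bullet> y\<bar> - (x\<^sub>0 \<bullet> y) * (x\<^sub>0 \<bullet> y) \<partial>M) = 0"
        using i0 sq[of x\<^sub>0] x0_Sph by (simp add: norm_eq_1)
    qed (use sq_le[OF x0] msupport_subset in auto)
    moreover have "\<bar>x\<^sub>0 \<bullet> y\<bar> * (1 - \<bar>x\<^sub>0 \<bullet> y\<bar>) = \<bar>x\<^sub>0 \<bullet> y\<bar> - (x\<^sub>0 \<bullet> y) * (x\<^sub>0 \<bullet> y)"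
      by (simp add: right_diff_distrib)
    ultimately have "\<bar>x\<^sub>0 \<bullet> y\<bar> * (1 - \<bar>x\<^sub>0 \<bullet> y\<bar>) = 0" by simp
    then have "\<bar>x\<^sub>0 \<bullet> y\<bar> = 1" using x0_inner[OF y] \<delta> by auto
    then show ?thesis by (metis abs_mult_self_eq mult_1)
  qed
  obtain v where v: "v \<noteq> 0" "orthogonal x\<^sub>0 v" using orthogonal_to_vector_exists[OF dim] by blast
  have "v \<bullet> y = 0" if y: "y \<in> S" for y
  proof -
    have "y \<bullet> y = 1" "x\<^sub>0 \<bullet> x\<^sub>0 = 1" using y x0 msupport_subset by (auto simp flip: norm_eq_1)
    then have "(y - (x\<^sub>0 \<bullet> y) *\<^sub>R x\<^sub>0) \<bullet> (y - (x\<^sub>0 \<bullet> y) *\<^sub>R x\<^sub>0) = 0"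
      using one[OF y] by (simp add: inner_diff_left inner_diff_right inner_commute)
    then have "y = (x\<^sub>0 \<bullet> y) *\<^sub>R x\<^sub>0" by simp
    then have "v \<bullet> y = (x\<^sub>0 \<bullet> y) * (v \<bullet> x\<^sub>0)" by (metis inner_scaleR_right)
    then show ?thesis using v(2) by (simp add: orthogonal_def inner_commute)
  qed
  then have "(\<integral>y. (v \<bullet> y) * (v \<bullet> y) \<partial>M) = (\<integral>y. 0 \<partial>M)"
    by (intro integral_cong_msupport continuous_on_measurable continuous_intros) simp
  then show False using sq[of v] c(1) v(1) by simp
qed

end

subsection \<open>The dimension bound\<close>

context frame3_minimizer
begin

lemma nonorthogonal_null:
  assumes s: "s > real DIM('a) - 2" "s > 0" and dim: "DIM('a) \<ge> 2"
  shows "hausdorff_outer s {x \<in> S. \<forall>y\<in>S. x \<bullet> y \<noteq> 0} = 0" (is "hausdorff_outer s ?E = 0")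
proof (rule hausdorff_null_locally)
  fix x assume x: "x \<in> ?E"
  have "continuous_on S (\<lambda>y. \<bar>x \<bullet> y\<bar>)" by (intro continuous_intros)
  then obtain y where y: "y \<in> S" "\<And>z. z \<in> S \<Longrightarrow> \<bar>x \<bullet> y\<bar> \<le> \<bar>x \<bullet> z\<bar>"
    using continuous_attains_inf[OF compact_msupport, of "\<lambda>y. \<bar>x \<bullet> y\<bar>"] x by auto
  define \<delta> where "\<delta> = \<bar>x \<bullet> y\<bar>"
  have \<delta>: "\<delta> > 0" using x y(1) by (simp add: \<delta>_def)
  interpret frame3_nonorthogonal M x \<delta>
    by unfold_locales (use x \<delta> y(2) in \<open>auto simp: \<delta>_def\<close>)
  obtain w where "q w w \<noteq> 0" using q_not_zero[OF dim] by blast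
  then obtain u where u: "u \<noteq> 0" "S \<inter> ball x \<delta> \<subseteq> {z \<in> Sph. u \<bullet> z = 0}"
    using hyperplane_if_q_nonzero by blast
  have "hausdorff_outer s (?E \<inter> ball x \<delta>) = 0"
    by (rule hausdorff_null_subset[OF hyperplane_slice_null[OF u(1) s dim]]) (use u(2) in blast)
  then show "\<exists>r>0. hausdorff_outer s (?E \<inter> ball x r) = 0" using \<delta> by blast
qed

lemma orthogonal_null:
  assumes s: "s > real DIM('a) - 2" "s > 0" and dim: "DIM('a) \<ge> 2"
    and h: "h > 0" "\<And>x y. x \<in> S \<Longrightarrow> y \<in> S \<Longrightarrow> h \<le> H x y"
  shows "hausdorff_outer s {x \<in> S. \<exists>y\<in>S. x \<bullet> y = 0} = 0"
proof -
  define \<delta> where "\<delta> = 1 / (4 * (4 / h + 2))"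
  have \<delta>: "\<delta> > 0" "(4 / h + 2) * \<delta> = 1 / 4"
    using h(1) by (auto simp: \<delta>_def divide_simps add_pos_pos)
  obtain K where K: "finite K" "S \<subseteq> (\<Union>c\<in>K. ball c \<delta>)"
    using compact_msupport \<delta>(1) unfolding compact_eq_totally_bounded by blast
  define E where "E c = {x \<in> S. \<exists>y\<in>S \<inter> ball c \<delta>. x \<bullet> y = 0}" for c
  have "hausdorff_outer s (E c) = 0" for c
  proof (rule sphere_slice_null[OF _ _ s dim])
    show "E c \<subseteq> Sph" using msupport_subset by (auto simp: E_def)
    fix x assume "x \<in> E c"
    then obtain b where b: "b \<in> S" "b \<in> ball c \<delta>" "x \<bullet> b = 0" by (auto simp: E_def)
    have "\<bar>(p - p') \<bullet> b\<bar> \<le> norm (p - p') / 4" if pp: "p \<in> E c" "p' \<in> E c" for p p'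
    proof -
      obtain y y' where y: "y \<in> S" "y \<in> ball c \<delta>" "p \<bullet> y = 0"
        and y': "y' \<in> S" "y' \<in> ball c \<delta>" "p' \<bullet> y' = 0"
        using pp by (auto simp: E_def)
      have p: "p \<in> S" "p' \<in> S" using pp by (auto simp: E_def)
      have yy: "norm (y - y') \<le> 2 * \<delta>" "norm (b - y) \<le> 2 * \<delta>"
        using b(2) y(2) y'(2) dist_triangle2[of y y' c] dist_triangle2[of b y c]
        by (auto simp: dist_norm norm_minus_commute)
      have "\<bar>p' \<bullet> y\<bar> * h \<le> G p' y"
        unfolding G_def using h(2)[OF p(2) y(1)] by (intro mult_left_mono) auto
      also have "\<dots> \<le> G p y' + G p' y" using H_nonneg by (simp add: G_def)
      also have "\<dots> \<le> 2 * norm (p - p') * norm (y - y')"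
        by (rule G_orthogonal_pairs[OF p y(1) y'(1) y(3) y'(3)])
      also have "\<dots> \<le> 2 * norm (p - p') * (2 * \<delta>)"
        using yy(1) by (intro mult_left_mono) auto
      finally have 1: "\<bar>p' \<bullet> y\<bar> \<le> 4 / h * \<delta> * norm (p - p')"
        using h(1) by (simp add: field_simps)
      have "(p - p') \<bullet> b = (p - p') \<bullet> (b - y) - p' \<bullet> y"
        using y(3) by (simp add: inner_diff_left inner_diff_right)
      then have "\<bar>(p - p') \<bullet> b\<bar> \<le> \<bar>(p - p') \<bullet> (b - y)\<bar> + \<bar>p' \<bullet> y\<bar>" by linarith
      also have "\<bar>(p - p') \<bullet> (b - y)\<bar> \<le> norm (p - p') * (2 * \<delta>)"
        using yy(2) by (intro order_trans[OF Cauchy_Schwarz_ineq2] mult_left_mono) auto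
      finally have "\<bar>(p - p') \<bullet> b\<bar> \<le> (4 / h + 2) * \<delta> * norm (p - p')"
        using 1 by (simp add: algebra_simps)
      then show ?thesis unfolding \<delta>(2) by simp
    qed
    moreover have "norm b = 1" using b(1) msupport_subset by auto
    ultimately show "\<exists>b r. norm b = 1 \<and> x \<bullet> b = 0 \<and> r > 0 \<and>
        (\<forall>y\<in>E c \<inter> ball x r. \<forall>z\<in>E c \<inter> ball x r. \<bar>(y - z) \<bullet> b\<bar> \<le> norm (y - z) / 4)"
      using b(3) by (intro exI[of _ b] exI[of _ 1]) auto
  qed
  then have "hausdorff_outer s (\<Union>(E ` K)) = 0"
    using K(1) by (intro hausdorff_null_countable_Union) (auto intro: countable_finite)
  moreover have "{x \<in> S. \<exists>y\<in>S. x \<bullet> y = 0} \<subseteq> \<Union>(E ` K)"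
    using K(2) by (fastforce simp: E_def)
  ultimately show ?thesis using hausdorff_null_subset by blast
qed

lemma msupport_null:
  assumes s: "s > real DIM('a) - 2" "s > 0" and dim: "DIM('a) \<ge> 2"
  shows "hausdorff_outer s S = 0"
proof (cases "\<exists>x\<in>S. \<exists>y\<in>S. H x y = 0")
  case True
  then obtain x y where xy: "x \<in> S" "y \<in> S" "H x y = 0" by blast
  have "\<bar>x \<bullet> z\<bar> * \<bar>y \<bullet> z\<bar> = 0" if "z \<in> S" for z
    by (rule zero_on_msupport[OF _ _ _ that]) (use xy(3) in \<open>auto simp: H_def intro!: continuous_intros\<close>)
  then have sub: "S \<subseteq> {z \<in> Sph. x \<bullet> z = 0} \<union> {z \<in> Sph. y \<bullet> z = 0}"
    using msupport_subset by auto
  have "x \<noteq> 0" "y \<noteq> 0" using xy msupport_subset by auto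
  then show ?thesis
    by (intro hausdorff_null_subset[OF hausdorff_null_Un sub] hyperplane_slice_null s dim)
next
  case False
  show ?thesis
  proof (cases "S = {}")
    case ne: False
    have "continuous_on (S \<times> S) (\<lambda>(x, y). H x y)"
      by (rule continuous_on_subset[OF continuous_on_H]) (use msupport_subset in auto)
    then obtain p where p: "p \<in> S \<times> S" "\<And>r. r \<in> S \<times> S \<Longrightarrow> (case p of (x, y) \<Rightarrow> H x y) \<le> (case r of (x, y) \<Rightarrow> H x y)"
      using continuous_attains_inf[of "S \<times> S" "\<lambda>(x, y). H x y"] compact_Times[OF compact_msupport compact_msupport] ne
      by auto
    define h where "h = (case p of (x, y) \<Rightarrow> H x y)"
    have "h > 0" using p(1) False H_nonneg by (auto simp: h_def less_le)
    moreover have "h \<le> H x y" if "x \<in> S" "y \<in> S" for x y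
      using p(2)[of "(x, y)"] that by (simp add: h_def)
    ultimately have "hausdorff_outer s {x \<in> S. \<exists>y\<in>S. x \<bullet> y = 0} = 0"
      by (rule orthogonal_null[OF s dim])
    from hausdorff_null_Un[OF this nonorthogonal_null[OF s dim]]
    show ?thesis by (rule hausdorff_null_subset) blast
  qed simp
qed

end

theorem theorem6p2:
  fixes \<mu> :: "(real ^ 'n) measure"
  assumes "CARD('n) \<ge> 2"
    and "sphere_prob \<mu>"
    and "\<And>\<nu> :: (real ^ 'n) measure. sphere_prob \<nu> \<Longrightarrow> frame3_energy \<mu> \<le> frame3_energy \<nu>"
  shows "hausdorff_dim (msupport \<mu>) \<le> real CARD('n) - 2"
proof -
  interpret prob_space \<mu> using assms(2) by (simp add: sphere_prob_def)
  interpret frame3_minimizer \<mu>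
    by unfold_locales (use assms(2,3) in \<open>auto simp: sphere_prob_def\<close>)
  show ?thesis
    using assms(1) by (intro hausdorff_dim_le msupport_null) auto
qed

end
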